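(* Let $\mathbb{F}_\theta^+$ be an aperiodic single vertex $k$-graph with the little pull-back property. Then for each $A\in\mathcal{O}_\theta$, $$\overline{\{\alpha(A):\alpha\in \mathsf{Ave}(\mathcal{O}_\theta,\mathcal{U}(\mathcal{X}_0))\}}^{\|\cdot\|}\cap\mathbb{C}I\neq\varnothing.$$
   Context: A single vertex $k$-graph $\Lambda=\mathbb{F}_\theta^+$ is a monoid (a small category with one object) with a degree homomorphism $d:\Lambda\to\mathbb{N}^k$ satisfying the factorization property: whenever $d(\lambda)=p+q$ with $p,q\in\mathbb{N}^k$, there are unique $\mu,\nu\in\Lambda$ with $\lambda=\mu\nu$, $d(\mu)=p$, $d(\nu)=q$. Let $\epsilon_1,\ldots,\epsilon_k$ be the standard generators of $\mathbb{Z}^k$. The elements of degree $\epsilon_i$ are the edges $e^i_1,\ldots,e^i_{m_i}$, finitely many; for $i<j$ the relations $e^i_{s}e^j_{t}=e^j_{t'}e^i_{s'}$ define permutations $\theta_{ij}(s,t)=(s',t')$. Little pull-back property: for edges $e,f$ of distinct degrees, $|\Lambda^{\min}(e,f)|\le 1$, where $\Lambda^{\min}(\mu,\nu)=\{(\xi,\eta)\in\Lambda\times\Lambda:\mu\xi=\nu\eta,\ d(\mu\xi)=d(\mu)\vee d(\nu)\}$ and $\vee$ is the coordinatewise maximum. A tuple $(V_1,\ldots,V_n)$ in a unital C*-algebra is of Cuntz-type if $V_i^*V_j=\delta_{i,j}I$ and $\sum_iV_iV_i^*=I$. A Cuntz-type representation of $\mathbb{F}_\theta^+$ consists of Cuntz-type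 tuples $E^i=(E^i_1,\ldots,E^i_{m_i})$ ($1\le i\le k$) satisfying $E^i_sE^j_t=E^j_{t'}E^i_{s'}$ whenever $i<j$ and $\theta_{ij}(s,t)=(s',t')$. $\mathcal{O}_\theta$ is the universal C*-algebra for Cuntz-type representations, with generators $s_{e^i_t}$, and $s_w$ denotes the product of generators along a word $w$. $\mathbb{F}_\theta^+$ is aperiodic if and only if $\mathcal{O}_\theta$ is simple (this may be taken as the definition). $\mathcal{X}_0=\operatorname{span}\{s_us_v^*:u,v\in\mathbb{F}_\theta^+,\ d(u)=d(v)\}$ (algebraic span), a unital *-subalgebra of $\mathcal{O}_\theta$, and $\mathcal{U}(\mathcal{X}_0)$ is its group of unitaries. For a unital C*-algebra $\mathcal{A}$ and a subgroup $\mathcal{V}$ of its unitary group, $\mathsf{Ave}(\mathcal{A},\mathcal{V})$ is the set of all maps $\alpha(A)=\sum_{i=1}^n\lambda_iU_iAU_i^*$ on $\mathcal{A}$ with $n\ge1$, $U_i\in\mathcal{V}$, $\lambda_i>0$, $\sum_i\lambda_i=1$. *)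

theory Defs
  imports "HOL-Analysis.Analysis" "HOL-Algebra.Ideal"
begin

text \<open>
  A C*-algebra that occupies a whole type is an instance of the class below;
  \<open>real_normed_algebra_1\<close> contributes \<open>norm 1 = 1\<close> and \<open>1 \<noteq> 0\<close>, so the zero algebra is excluded.
\<close>

class cstar_algebra = real_normed_algebra_1 + banach +
  fixes scaleC :: "complex \<Rightarrow> 'a \<Rightarrow> 'a"  (infixr "*\<^sub>C" 75)
    and star :: "'a \<Rightarrow> 'a"
  assumes scaleC_add_right: "c *\<^sub>C (x + y) = c *\<^sub>C x + c *\<^sub>C y"
    and scaleC_add_left: "(c + d) *\<^sub>C x = c *\<^sub>C x + d *\<^sub>C x"
    and scaleC_scaleC: "c *\<^sub>C (d *\<^sub>C x) = (c * d) *\<^sub>C x"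
    and scaleR_eq_scaleC: "r *\<^sub>R x = complex_of_real r *\<^sub>C x"
    and scaleC_mult_left: "(c *\<^sub>C x) * y = c *\<^sub>C (x * y)"
    and scaleC_mult_right: "x * (c *\<^sub>C y) = c *\<^sub>C (x * y)"
    and norm_scaleC: "norm (c *\<^sub>C x) = cmod c * norm x"
    and star_add: "star (x + y) = star x + star y"
    and star_scaleC: "star (c *\<^sub>C x) = cnj c *\<^sub>C star x"
    and star_mult: "star (x * y) = star y * star x"
    and star_star: "star (star x) = x"
    and norm_star_mult: "norm (star x * x) = (norm x)\<^sup>2"

lemma vector_space_scaleC:
  "vector_space (scaleC :: complex \<Rightarrow> 'a::cstar_algebra \<Rightarrow> 'a)"
proof
  fix x :: 'a
  show "1 *\<^sub>C x = x"
    using scaleR_eq_scaleC[of 1 x] by simp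
qed (simp_all add: scaleC_add_right scaleC_add_left scaleC_scaleC)

text \<open>
  The universal property of \<open>\<O>\<^sub>\<theta>\<close> quantifies over C*-algebras inside a formula, which a class
  cannot do.  The test algebras are therefore records with an explicit carrier.
\<close>

record 'a cstar_ring = "'a ring" +
  cscale :: "complex \<Rightarrow> 'a \<Rightarrow> 'a"
  cadj :: "'a \<Rightarrow> 'a"
  cnorm :: "'a \<Rightarrow> real"

locale unital_cstar = ring B for B :: "'a cstar_ring" (structure) +
  assumes one_neq_zero: "\<one> \<noteq> \<zero>"
    and cscale_closed: "x \<in> carrier B \<Longrightarrow> cscale B c x \<in> carrier B"
    and cadj_closed: "x \<in> carrier B \<Longrightarrow> cadj B x \<in> carrier B"
    and cscale_one: "x \<in> carrier B \<Longrightarrow> cscale B 1 x = x"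
    and cscale_add_right: "\<lbrakk>x \<in> carrier B; y \<in> carrier B\<rbrakk>
          \<Longrightarrow> cscale B c (x \<oplus> y) = cscale B c x \<oplus> cscale B c y"
    and cscale_add_left: "x \<in> carrier B \<Longrightarrow> cscale B (c + d) x = cscale B c x \<oplus> cscale B d x"
    and cscale_cscale: "x \<in> carrier B \<Longrightarrow> cscale B c (cscale B d x) = cscale B (c * d) x"
    and cscale_mult_left: "\<lbrakk>x \<in> carrier B; y \<in> carrier B\<rbrakk>
          \<Longrightarrow> cscale B c x \<otimes> y = cscale B c (x \<otimes> y)"
    and cscale_mult_right: "\<lbrakk>x \<in> carrier B; y \<in> carrier B\<rbrakk>
          \<Longrightarrow> x \<otimes> cscale B c y = cscale B c (x \<otimes> y)"
    and cadj_add: "\<lbrakk>x \<in> carrier B; y \<in> carrier B\<rbrakk> \<Longrightarrow> cadj B (x \<oplus> y) = cadj B x \<oplus> cadj B y"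
    and cadj_cscale: "x \<in> carrier B \<Longrightarrow> cadj B (cscale B c x) = cscale B (cnj c) (cadj B x)"
    and cadj_mult: "\<lbrakk>x \<in> carrier B; y \<in> carrier B\<rbrakk> \<Longrightarrow> cadj B (x \<otimes> y) = cadj B y \<otimes> cadj B x"
    and cadj_cadj: "x \<in> carrier B \<Longrightarrow> cadj B (cadj B x) = x"
    and cnorm_nonneg: "x \<in> carrier B \<Longrightarrow> 0 \<le> cnorm B x"
    and cnorm_eq_zero: "x \<in> carrier B \<Longrightarrow> cnorm B x = 0 \<longleftrightarrow> x = \<zero>"
    and cnorm_triangle: "\<lbrakk>x \<in> carrier B; y \<in> carrier B\<rbrakk>
          \<Longrightarrow> cnorm B (x \<oplus> y) \<le> cnorm B x + cnorm B y"
    and cnorm_cscale: "x \<in> carrier B \<Longrightarrow> cnorm B (cscale B c x) = cmod c * cnorm B x"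
    and cnorm_mult: "\<lbrakk>x \<in> carrier B; y \<in> carrier B\<rbrakk> \<Longrightarrow> cnorm B (x \<otimes> y) \<le> cnorm B x * cnorm B y"
    and cnorm_cadj_mult: "x \<in> carrier B \<Longrightarrow> cnorm B (cadj B x \<otimes> x) = (cnorm B x)\<^sup>2"
    and cnorm_complete: "\<lbrakk>range X \<subseteq> carrier B;
            \<And>e. e > 0 \<Longrightarrow> \<exists>N. \<forall>m\<ge>N. \<forall>n\<ge>N. cnorm B (X m \<ominus> X n) < e\<rbrakk>
          \<Longrightarrow> \<exists>x\<in>carrier B. (\<lambda>n. cnorm B (X n \<ominus> x)) \<longlonglongrightarrow> 0"

definition star_hom :: "'a cstar_ring \<Rightarrow> 'b cstar_ring \<Rightarrow> ('a \<Rightarrow> 'b) \<Rightarrow> bool" where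
  "star_hom A B h \<longleftrightarrow>
     h \<in> ring_hom A B \<and>
     (\<forall>c. \<forall>x\<in>carrier A. h (cscale A c x) = cscale B c (h x)) \<and>
     (\<forall>x\<in>carrier A. h (cadj A x) = cadj B (h x))"

definition cstar_univ :: "'a::cstar_algebra cstar_ring" where
  "cstar_univ = \<lparr>carrier = UNIV, mult = (*), one = 1, zero = 0, add = (+),
                 cscale = scaleC, cadj = star, cnorm = norm\<rparr>"

lemma cstar_univ_simps [simp]:
  "carrier cstar_univ = UNIV" "mult cstar_univ = (*)" "one cstar_univ = 1"
  "zero cstar_univ = 0" "add cstar_univ = (+)"
  "cscale cstar_univ = scaleC" "cadj cstar_univ = star" "cnorm cstar_univ = norm"
  by (simp_all add: cstar_univ_def)

lemma ring_cstar_univ: "ring (cstar_univ :: 'a::cstar_algebra cstar_ring)"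
proof (rule ringI)
  show "abelian_group (cstar_univ :: 'a cstar_ring)"
    by (rule abelian_groupI)
      (auto simp: algebra_simps intro: exI[of _ "- x" for x] left_minus)
  show "monoid (cstar_univ :: 'a cstar_ring)"
    by (rule monoidI) (auto simp: algebra_simps)
qed (auto simp: algebra_simps)

lemma minus_cstar_univ [simp]:
  "x \<ominus>\<^bsub>cstar_univ\<^esub> y = x - (y :: 'a::cstar_algebra)"
proof -
  interpret ring "cstar_univ :: 'a cstar_ring" by (rule ring_cstar_univ)
  have "\<ominus>\<^bsub>cstar_univ\<^esub> y = - y"
    by (rule minus_equality) auto
  then show ?thesis
    by (simp add: a_minus_def)
qed

lemma finsum_cstar_univ [simp]:
  fixes f :: "'i \<Rightarrow> 'a::cstar_algebra"
  assumes "finite S"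
  shows "finsum cstar_univ f S = sum f S"
proof -
  interpret ring "cstar_univ :: 'a cstar_ring" by (rule ring_cstar_univ)
  show ?thesis using assms by induction (auto simp: finsum_insert)
qed

lemma unital_cstar_cstar_univ: "unital_cstar (cstar_univ :: 'a::cstar_algebra cstar_ring)"
proof -
  interpret V: vector_space "scaleC :: complex \<Rightarrow> 'a \<Rightarrow> 'a" by (rule vector_space_scaleC)
  have complete: "\<exists>x. (\<lambda>n. norm (X n - x)) \<longlonglongrightarrow> 0"
    if "\<And>e. e > 0 \<Longrightarrow> \<exists>N. \<forall>m\<ge>N. \<forall>n\<ge>N. norm (X m - X n) < e" for X :: "nat \<Rightarrow> 'a"
  proof -
    have "Cauchy X"
      using that by (simp add: Cauchy_def dist_norm)
    then obtain x where "X \<longlonglongrightarrow> x"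
      using convergent_eq_Cauchy by blast
    then show ?thesis
      using LIM_zero tendsto_norm_zero by blast
  qed
  show ?thesis
    by (intro unital_cstar.intro unital_cstar_axioms.intro ring_cstar_univ)
      (use complete in \<open>auto simp: scaleC_add_right scaleC_add_left scaleC_scaleC scaleC_mult_left
          scaleC_mult_right norm_scaleC star_add star_scaleC star_mult star_star norm_star_mult
          norm_triangle_ineq norm_mult_ineq\<close>)
qed

definition scalars :: "'a::cstar_algebra set" where
  "scalars = range (\<lambda>c. c *\<^sub>C 1)"

definition unitaries :: "'a::cstar_algebra set \<Rightarrow> 'a set" where
  "unitaries S = {U \<in> S. star U * U = 1 \<and> U * star U = 1}"

definition Ave :: "'a::cstar_algebra set \<Rightarrow> ('a \<Rightarrow> 'a) set" where
  "Ave V = {\<alpha>. \<exists>(n::nat) (r :: nat \<Rightarrow> real) U. 1 \<le> n \<and>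
              (\<forall>i\<in>{1..n}. U i \<in> V \<and> r i > 0) \<and> (\<Sum>i=1..n. r i) = 1 \<and>
              \<alpha> = (\<lambda>A. \<Sum>i=1..n. r i *\<^sub>R (U i * A * star (U i)))}"

text \<open>An ideal of a unital algebra is automatically a complex subspace.\<close>

definition cstar_simple :: "'a::cstar_algebra itself \<Rightarrow> bool" where
  "cstar_simple _ \<longleftrightarrow>
     (\<forall>I :: 'a set. ideal I cstar_univ \<and> closed I \<longrightarrow> I = {0} \<or> I = UNIV)"

definition star_subalgebra :: "'a::cstar_algebra set \<Rightarrow> bool" where
  "star_subalgebra S \<longleftrightarrow> 1 \<in> S \<and>
     (\<forall>x\<in>S. \<forall>y\<in>S. x + y \<in> S \<and> x * y \<in> S) \<and> (\<forall>c. \<forall>x\<in>S. c *\<^sub>C x \<in> S \<and> star x \<in> S)"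

text \<open>
  The finite index type \<open>'k\<close> plays the role of \<open>{1,\<dots>,k}\<close>, and \<open>axis i 1\<close> that of \<open>\<epsilon>\<^sub>i\<close>.
\<close>

definition edges :: "('l \<Rightarrow> nat ^ 'k) \<Rightarrow> 'k \<Rightarrow> 'l set" where
  "edges d i = {e. d e = axis i 1}"

definition all_edges :: "('l \<Rightarrow> nat ^ 'k) \<Rightarrow> 'l set" where
  "all_edges d = (\<Union>i. edges d i)"

locale single_vertex_kgraph =
  fixes d :: "'l::monoid_mult \<Rightarrow> nat ^ 'k"
  assumes degree_one: "d 1 = 0"
    and degree_mult: "d (x * y) = d x + d y"
    and factorization: "d l = p + q \<Longrightarrow> \<exists>!(m, n). l = m * n \<and> d m = p \<and> d n = q"
    and finite_edges: "finite (edges d i)"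

definition Lambda_min :: "('l::monoid_mult \<Rightarrow> nat ^ 'k) \<Rightarrow> 'l \<Rightarrow> 'l \<Rightarrow> ('l \<times> 'l) set" where
  "Lambda_min d m n =
     {(x, y). m * x = n * y \<and> d (m * x) = (\<chi> i. max (d m $ i) (d n $ i))}"

text \<open>Finiteness is stated explicitly because \<open>card\<close> is \<open>0\<close> on infinite sets.\<close>

definition little_pullback :: "('l::monoid_mult \<Rightarrow> nat ^ 'k) \<Rightarrow> bool" where
  "little_pullback d \<longleftrightarrow>
     (\<forall>i j. \<forall>e\<in>edges d i. \<forall>f\<in>edges d j. i \<noteq> j \<longrightarrow>
        finite (Lambda_min d e f) \<and> card (Lambda_min d e f) \<le> 1)"

definition cuntz_tuple :: "'a cstar_ring \<Rightarrow> 'l set \<Rightarrow> ('l \<Rightarrow> 'a) \<Rightarrow> bool" where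
  "cuntz_tuple B J V \<longleftrightarrow>
     (\<forall>e\<in>J. V e \<in> carrier B) \<and>
     (\<forall>e\<in>J. \<forall>f\<in>J. cadj B (V e) \<otimes>\<^bsub>B\<^esub> V f = (if e = f then \<one>\<^bsub>B\<^esub> else \<zero>\<^bsub>B\<^esub>)) \<and>
     (\<Oplus>\<^bsub>B\<^esub>e\<in>J. V e \<otimes>\<^bsub>B\<^esub> cadj B (V e)) = \<one>\<^bsub>B\<^esub>"

text \<open>
  The tuples are indexed by the edges themselves: \<open>E\<close> at the edge \<open>e\<^sup>i\<^sub>s\<close> is \<open>E\<^sup>i\<^sub>s\<close>, and values of
  \<open>E\<close> off the edges are irrelevant.  For edges \<open>e, e'\<close> of degree \<open>\<epsilon>\<^sub>i\<close> and \<open>f, f'\<close> of degree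
  \<open>\<epsilon>\<^sub>j\<close>, the equation \<open>e * f = f' * e'\<close> says that \<open>\<theta>\<^sub>i\<^sub>j\<close> sends the indices of \<open>(e, f)\<close> to those of
  \<open>(e', f')\<close>.  Both this and the relation imposed on \<open>E\<close> are invariant under swapping
  \<open>(i, e, f)\<close> with \<open>(j, f', e')\<close>, so \<open>i \<noteq> j\<close> can replace \<open>i < j\<close> and no order on
  \<open>'k\<close> is needed.
\<close>

definition cuntz_rep ::
  "('l::monoid_mult \<Rightarrow> nat ^ 'k) \<Rightarrow> 'a cstar_ring \<Rightarrow> ('l \<Rightarrow> 'a) \<Rightarrow> bool" where
  "cuntz_rep d B E \<longleftrightarrow>
     (\<forall>i. cuntz_tuple B (edges d i) E) \<and>
     (\<forall>i j. \<forall>e\<in>edges d i. \<forall>e'\<in>edges d i. \<forall>f\<in>edges d j. \<forall>f'\<in>edges d j.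
        i \<noteq> j \<and> e * f = f' * e' \<longrightarrow> E e \<otimes>\<^bsub>B\<^esub> E f = E f' \<otimes>\<^bsub>B\<^esub> E e')"

text \<open>
  \<open>universal_cuntz_rep d s\<close> says that the ambient type \<open>'a\<close> is (a copy of) \<open>\<O>\<^sub>\<theta>\<close>, with canonical
  generators \<open>s\<close>: it is generated as a C*-algebra by a Cuntz-type representation \<open>s\<close>
  through which every Cuntz-type representation factors.  Letting the test algebras range only over
  carriers inside \<open>'a\<close> loses nothing: a Cuntz-type representation generates a separable
  C*-algebra, hence one with at most continuum many elements, while \<open>'a\<close> has at least that many
  as it contains the complex scalars.  Uniqueness of \<open>h\<close> follows from generation.
\<close>

definition universal_cuntz_rep ::
  "('l::monoid_mult \<Rightarrow> nat ^ 'k) \<Rightarrow> ('l \<Rightarrow> 'a::cstar_algebra) \<Rightarrow> bool" where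
  "universal_cuntz_rep d s \<longleftrightarrow>
     cuntz_rep d cstar_univ s \<and>
     (\<forall>S. star_subalgebra S \<and> closed S \<and> s ` all_edges d \<subseteq> S \<longrightarrow> S = UNIV) \<and>
     (\<forall>(B :: 'a cstar_ring) E. unital_cstar B \<and> cuntz_rep d B E \<longrightarrow>
        (\<exists>h. star_hom cstar_univ B h \<and> (\<forall>e\<in>all_edges d. h (s e) = E e)))"

text \<open>
  Elements of \<open>\<Lambda>\<close> enter through words \<open>u\<close> of edges: such a word represents \<open>prod_list u\<close>, and
  \<open>s\<^sub>u\<close> is the product of the generators along it.  By the commutation relations \<open>s\<^sub>u\<close> depends
  only on \<open>prod_list u\<close>.
\<close>

definition gen_word :: "('l \<Rightarrow> 'a::monoid_mult) \<Rightarrow> 'l list \<Rightarrow> 'a" where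
  "gen_word s u = prod_list (map s u)"

definition X0 :: "('l::monoid_mult \<Rightarrow> nat ^ 'k) \<Rightarrow> ('l \<Rightarrow> 'a::cstar_algebra) \<Rightarrow> 'a set" where
  "X0 d s = module.span scaleC
     {gen_word s u * star (gen_word s v) | u v.
        set u \<subseteq> all_edges d \<and> set v \<subseteq> all_edges d \<and> d (prod_list u) = d (prod_list v)}"

text \<open>
  \<open>\<Lambda>\<close> is aperiodic if and only if \<open>\<O>\<^sub>\<theta>\<close> is simple; this is taken as the definition.
\<close>

definition aperiodic ::
  "('l::monoid_mult \<Rightarrow> nat ^ 'k) \<Rightarrow> ('l \<Rightarrow> 'a::cstar_algebra) \<Rightarrow> bool" where
  "aperiodic d s \<longleftrightarrow> universal_cuntz_rep d s \<and> cstar_simple TYPE('a)"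

end

theory Submission
  imports Defs
begin

text \<open>
  Write \<open>E i\<close> for the set of edges of degree \<open>\<epsilon>\<^sub>i\<close>, the edges of colour \<open>i\<close>, and \<open>m i\<close> for its size.  The proof plays two
  unital maps against each other: the compression \<open>T\<^sub>i A = (1 / m i) \<Sum>\<^sub>e s\<^sub>e\<^sup>* A s\<^sub>e\<close> and the
  amplification \<open>\<phi>\<^sub>i A = \<Sum>\<^sub>e s\<^sub>e A s\<^sub>e\<^sup>*\<close>, sums over \<open>e \<in> E i\<close>.  The elements \<open>s\<^sub>e s\<^sub>f\<^sup>*\<close> with
  \<open>e, f \<in> E i\<close> are matrix units, and averaging \<open>A\<close> over a finite group of monomial matrices
  produces \<open>\<phi>\<^sub>i T\<^sub>i A\<close>.  Iterating this, \<open>\<phi>\<^sub>w T\<^sub>w\<close> is an average by unitaries of \<open>\<X>\<^sub>0\<close> for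
  every word \<open>w\<close> of colours (\<open>amplify_compress_word_in_Ave\<close>).  Since \<open>\<phi>\<^sub>w\<close> is contractive and
  fixes the scalars, it suffices to find one scalar to which the elements \<open>T\<^sub>w A\<close> come arbitrarily
  close (\<open>compresses_to\<close>).

  The maps \<open>T\<^sub>i\<close> are contractive, fix the scalars and commute with each other.  Hence the elements
  that compress to a scalar form a closed subspace, and only the monomials \<open>s\<^sub>u s\<^sub>v\<^sup>*\<close>, whose span is
  dense, have to be treated.  If a colour \<open>i\<close> occurs in both \<open>u\<close> and \<open>v\<close>, then \<open>T\<^sub>i\<close> turns the
  monomial into a multiple of one with shorter words.  If \<open>i\<close> occurs in \<open>u\<close> but not in \<open>v\<close>, the
  little pull-back property makes \<open>T\<^sub>i (s\<^sub>u s\<^sub>v\<^sup>*)\<close> either zero or \<open>1 / m i\<close> times a monomial of the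
  same kind, so that the iterates of \<open>T\<^sub>i\<close> tend to \<open>0\<close> as soon as \<open>m i \<ge> 2\<close>; the case of a colour
  occurring only in \<open>v\<close> follows by taking adjoints.  What remains is the unit.

  The bound \<open>m i \<ge> 2\<close> (\<open>card_edges_ge_2\<close>) comes from simplicity.  If \<open>E i = {e}\<close>, then \<open>s\<^sub>e\<close> is a
  unitary and conjugation by it permutes the finitely many generators, so some power
  \<open>Z = s\<^sub>e\<^sup>N\<close> with \<open>N > 0\<close> is central.  In a simple algebra a central unitary is a scalar, but
  multiplying \<open>s\<^sub>e\<close> by an \<open>N\<close>-th root of \<open>- 1\<close> defines an endomorphism sending \<open>Z\<close> to \<open>- Z\<close>.
\<close>

section \<open>C*-algebras\<close>

interpretation cstar_vs: vector_space "scaleC :: complex \<Rightarrow> 'a \<Rightarrow> 'a::cstar_algebra"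
  by (rule vector_space_scaleC)

lemma star_zero [simp]: "star (0::'a::cstar_algebra) = 0"
  using star_add[of "0::'a" 0] by simp

lemma star_one [simp]: "star (1::'a::cstar_algebra) = 1"
  using star_mult[of "star 1::'a" 1] by (simp add: star_star)

lemma star_minus: "star (- x) = - star (x::'a::cstar_algebra)"
  using star_add[of x "- x"] by (simp add: eq_neg_iff_add_eq_0 add.commute)

lemma star_diff: "star (x - y) = star x - star (y::'a::cstar_algebra)"
  using star_add[of x "- y"] by (simp add: star_minus)

lemma star_scaleR: "star (r *\<^sub>R x) = r *\<^sub>R star (x::'a::cstar_algebra)"
  by (simp add: scaleR_eq_scaleC star_scaleC)

lemma star_sum: "star (sum f S) = (\<Sum>i\<in>S. star (f i :: 'a::cstar_algebra))"
  by (induction S rule: infinite_finite_induct) (simp_all add: star_add)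

lemma star_power: "star (x ^ n) = star (x::'a::cstar_algebra) ^ n"
  by (induction n) (simp_all add: star_mult power_commutes)

lemma norm_star [simp]: "norm (star x) = norm (x::'a::cstar_algebra)"
proof -
  have le: "norm y \<le> norm (star y)" for y :: 'a
  proof (cases "y = 0")
    case False
    have "norm y * norm y \<le> norm (star y) * norm y"
      using norm_mult_ineq[of "star y" y] by (simp add: norm_star_mult power2_eq_square)
    then show ?thesis using False by simp
  qed simp
  show ?thesis
    using le[of x] le[of "star x"] by (simp add: star_star)
qed

lemma continuous_on_star: "continuous_on S (star :: 'a::cstar_algebra \<Rightarrow> 'a)"
proof (rule continuous_onI)
  fix x e assume "(0::real) < e"
  then show "\<exists>d>0. \<forall>x'\<in>S. dist x' x < d \<longrightarrow> dist (star x') (star x :: 'a) \<le> e"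
    by (intro exI[of _ e]) (simp add: dist_norm flip: star_diff)
qed

lemma scaleC_sum_right: "c *\<^sub>C sum f S = (\<Sum>i\<in>S. c *\<^sub>C (f i :: 'a::cstar_algebra))"
  by (rule cstar_vs.scale_sum_right)

lemma scaleR_scaleC_commute: "r *\<^sub>R (c *\<^sub>C x) = c *\<^sub>C (r *\<^sub>R (x::'a::cstar_algebra))"
  by (simp add: scaleR_eq_scaleC mult.commute)

lemma norm_scaleC_one [simp]: "norm (c *\<^sub>C (1::'a::cstar_algebra)) = cmod c"
  by (simp add: norm_scaleC)

lemma norm_isometry:
  assumes "star v * v = (1::'a::cstar_algebra)"
  shows "norm v = 1"
proof -
  have "(norm v)\<^sup>2 = 1" using norm_star_mult[of v] assms by simp
  then show ?thesis using power2_eq_1_iff[of "norm v"] norm_ge_zero[of v] by linarith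
qed

text \<open>
  The C*-identity turns a bound \<open>c\<close> for \<open>\<phi>\<close> into the bound \<open>sqrt c\<close>, so the least bound is at
  most \<open>1\<close>.  This replaces the usual spectral radius argument when boundedness is known.
\<close>

lemma bounded_star_hom_contractive:
  fixes \<phi> :: "'a::cstar_algebra \<Rightarrow> 'a"
  assumes bl: "bounded_linear \<phi>"
    and hom: "\<And>x. \<phi> (star x * x) = star (\<phi> x) * \<phi> x"
  shows "norm (\<phi> x) \<le> norm x"
proof -
  define c where "c = onorm \<phi>"
  have c0: "0 \<le> c" unfolding c_def by (rule onorm_pos_le[OF bl])
  have "norm (\<phi> y) \<le> sqrt c * norm y" for y
  proof (rule power2_le_imp_le)
    have "(norm (\<phi> y))\<^sup>2 = norm (\<phi> (star y * y))" by (simp add: hom norm_star_mult)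
    also have "\<dots> \<le> c * norm (star y * y)" unfolding c_def by (rule onorm[OF bl])
    finally show "(norm (\<phi> y))\<^sup>2 \<le> (sqrt c * norm y)\<^sup>2"
      using c0 by (simp add: norm_star_mult power_mult_distrib)
  qed (use c0 in auto)
  then have "c \<le> sqrt c" unfolding c_def by (intro onorm_bound) (use c0 c_def in auto)
  then have "c\<^sup>2 \<le> (sqrt c)\<^sup>2" using c0 by (rule power_mono)
  then have "c * c \<le> 1 * c" using c0 by (simp add: power2_eq_square)
  then have "c \<le> 1"
    using mult_le_cancel_right[of c c 1] c0 by linarith
  then have "c * norm x \<le> norm x" using mult_right_mono[of c 1 "norm x"] by simp
  then show ?thesis
    using onorm[OF bl, of x] unfolding c_def by linarith
qed

section \<open>The spectrum of a unitary\<close>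

lemma roots_of_unity_orthogonal:
  fixes a b N :: nat
  assumes "a < N" "b < N"
  shows "(\<Sum>j<N. cis (2 * pi / N) ^ (j * a) * cnj (cis (2 * pi / N) ^ (j * b)))
           = (if a = b then of_nat N else 0)"
proof -
  define q where "q = cis (2 * pi * (real a - real b) / N)"
  have trm: "cis (2 * pi / N) ^ (j * a) * cnj (cis (2 * pi / N) ^ (j * b)) = q ^ j" for j
  proof -
    have "cis (2 * pi / N) ^ (j * a) * cnj (cis (2 * pi / N) ^ (j * b))
        = cis (real (j * a) * (2 * pi / N) + - (real (j * b) * (2 * pi / N)))"
      unfolding Complex.DeMoivre cis_cnj cis_mult ..
    also have "real (j * a) * (2 * pi / N) + - (real (j * b) * (2 * pi / N))
        = real j * (2 * pi * (real a - real b) / N)"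
      using assms by (simp add: field_simps)
    finally show ?thesis unfolding q_def Complex.DeMoivre .
  qed
  show ?thesis
  proof (cases "a = b")
    case False
    have "q \<noteq> 1"
    proof
      assume "q = 1"
      then have "cos (2 * pi * (real a - real b) / N) = 1"
        unfolding q_def by (metis cis.sel(1) one_complex.sel(1))
      then obtain k :: int where "2 * pi * (real a - real b) / N = real_of_int k * 2 * pi"
        unfolding cos_one_2pi_int by blast
      then have "2 * pi * (real a - real b) = 2 * pi * (k * real N)"
        using assms by (simp add: field_simps)
      then have "real_of_int (int a - int b) = real_of_int (k * int N)"
        by (subst (asm) mult_cancel_left) simp
      then have k: "int a - int b = k * int N" by linarith
      then have "int N dvd int a - int b" by simp
      then have "\<bar>int N\<bar> \<le> \<bar>int a - int b\<bar>" using False by (intro dvd_imp_le_int) auto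
      then show False using assms by linarith
    qed
    moreover have "q ^ N = 1"
    proof -
      have "q ^ N = cis (2 * pi * of_int (int a - int b))"
        using assms by (simp add: q_def Complex.DeMoivre)
      also have "\<dots> = 1" by (rule cis_multiple_2pi) (simp add: Ints_of_int[of "int a - int b", simplified])
      finally show ?thesis .
    qed
    ultimately show ?thesis
      using False unfolding trm by (simp add: sum_gp_strict)
  next
    case True
    then show ?thesis unfolding trm by (simp add: q_def)
  qed
qed

lemma isometry_power:
  fixes Z :: "'a::cstar_algebra"
  assumes "star Z * Z = 1"
  shows "star (Z ^ n) * Z ^ n = 1"
proof (induction n)
  case (Suc n)
  have "star (Z ^ Suc n) * Z ^ Suc n = star (Z ^ n) * (star Z * Z) * Z ^ n"
    by (simp add: star_mult mult.assoc)
  then show ?case using Suc assms by simp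
qed simp

lemma scaleC_power: "(c *\<^sub>C x) ^ n = c ^ n *\<^sub>C (x::'a::cstar_algebra) ^ n"
  by (induction n) (simp_all add: scaleC_mult_left scaleC_mult_right)

lemma geometric_sum_mult: "(\<Sum>i<n. x ^ i) * (1 - x) = 1 - (x::'a::ring_1) ^ n"
proof (induction n)
  case (Suc n)
  have "(\<Sum>i<Suc n. x ^ i) * (1 - x) = (1 - x ^ n) + x ^ n * (1 - x)"
    by (simp add: distrib_right Suc.IH)
  also have "\<dots> = 1 - x ^ Suc n"
    by (simp add: right_diff_distrib power_Suc2 del: power_Suc)
  finally show ?case .
qed simp

text \<open>
  Each factor \<open>1 - t\<^sup>N Z\<^sup>N\<close> times \<open>R (\<omega>\<^sup>j t)\<close> is a finite geometric series in \<open>\<omega>\<^sup>j t Z\<close>, because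
  \<open>(\<omega>\<^sup>j t)\<^sup>N = t\<^sup>N\<close>; summation over the roots of unity \<open>\<omega>\<^sup>j\<close> leaves only the constant terms.
\<close>

lemma resolvent_average:
  fixes Z :: "'a::cstar_algebra" and N :: nat
  assumes R: "\<And>\<zeta>. cmod \<zeta> = 1 \<Longrightarrow> (1 - \<zeta> *\<^sub>C Z) * R \<zeta> = 1"
    and "N > 0" "cmod t = 1"
  shows "(1 - t ^ N *\<^sub>C Z ^ N) * (\<Sum>j<N. R (cis (2 * pi / N) ^ j * t)) = of_nat N"
proof -
  define \<omega> where "\<omega> = cis (2 * pi / N)"
  have norm1: "cmod (\<omega> ^ j * t) = 1" for j
    using assms by (simp add: \<omega>_def norm_mult norm_power)
  have orth: "(\<Sum>j<N. \<omega> ^ (j * i)) = (if i = 0 then of_nat N else 0)" if "i < N" for i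
    using roots_of_unity_orthogonal[OF that \<open>N > 0\<close>] by (simp add: \<omega>_def)
  have "\<omega> ^ N = cis (2 * pi)" using \<open>N > 0\<close> by (simp add: \<omega>_def Complex.DeMoivre)
  then have \<omega>N: "(\<omega> ^ j) ^ N = 1" for j
    by (metis cis_2pi mult.commute power_mult power_one)
  have summand: "(1 - t ^ N *\<^sub>C Z ^ N) * R (\<omega> ^ j * t) = (\<Sum>i<N. (\<omega> ^ (j * i) * t ^ i) *\<^sub>C Z ^ i)" for j
  proof -
    have "t ^ N *\<^sub>C Z ^ N = ((\<omega> ^ j * t) *\<^sub>C Z) ^ N"
      by (simp add: scaleC_power power_mult_distrib \<omega>N)
    then have "(1 - t ^ N *\<^sub>C Z ^ N) * R (\<omega> ^ j * t)
        = (\<Sum>i<N. ((\<omega> ^ j * t) *\<^sub>C Z) ^ i) * ((1 - (\<omega> ^ j * t) *\<^sub>C Z) * R (\<omega> ^ j * t))"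
      by (simp add: geometric_sum_mult flip: mult.assoc)
    also have "\<dots> = (\<Sum>i<N. (\<omega> ^ (j * i) * t ^ i) *\<^sub>C Z ^ i)"
      by (simp add: R[OF norm1] scaleC_power power_mult_distrib flip: power_mult)
    finally show ?thesis .
  qed
  have "(1 - t ^ N *\<^sub>C Z ^ N) * (\<Sum>j<N. R (\<omega> ^ j * t))
      = (\<Sum>j<N. \<Sum>i<N. (\<omega> ^ (j * i) * t ^ i) *\<^sub>C Z ^ i)"
    by (simp add: sum_distrib_left summand)
  also have "\<dots> = (\<Sum>i<N. ((\<Sum>j<N. \<omega> ^ (j * i)) * t ^ i) *\<^sub>C Z ^ i)"
    by (subst sum.swap) (simp add: cstar_vs.scale_sum_left sum_distrib_right)
  also have "\<dots> = (\<Sum>i<N. if i = 0 then of_nat N *\<^sub>C 1 else 0)"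
    by (intro sum.cong) (auto simp: orth)
  also have "\<dots> = of_nat N"
    using \<open>N > 0\<close> scaleR_eq_scaleC[of "real N" "1::'a"] by (simp add: scaleR_conv_of_real)
  finally show ?thesis by (simp add: \<omega>_def)
qed

text \<open>
  Suppose that \<open>1 - \<zeta>Z\<close> has an inverse \<open>R \<zeta>\<close> for all \<open>\<zeta>\<close> on the circle.  By compactness \<open>R\<close> is
  bounded, hence Lipschitz.  The averages of \<open>R\<close> over the \<open>N\<close>-th roots of \<open>1\<close> and of \<open>- 1\<close> are
  the inverses of \<open>1 - Z\<^sup>N\<close> and \<open>1 + Z\<^sup>N\<close>; for large \<open>N\<close> the Lipschitz bound brings them close
  together, whereas \<open>(1 + Z\<^sup>N)(1 - Z\<^sup>N)\<close> times their difference is \<open>2 Z\<^sup>N\<close>, which keeps them apart.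
\<close>

lemma unitary_spectrum_nonempty:
  fixes Z :: "'a::cstar_algebra"
  assumes Z: "star Z * Z = 1"
  shows "\<exists>\<zeta>. cmod \<zeta> = 1 \<and> \<not> (\<exists>R. R * (1 - \<zeta> *\<^sub>C Z) = 1 \<and> (1 - \<zeta> *\<^sub>C Z) * R = 1)"
proof (rule ccontr)
  assume "\<not> ?thesis"
  then obtain R where Rl: "\<And>\<zeta>. cmod \<zeta> = 1 \<Longrightarrow> R \<zeta> * (1 - \<zeta> *\<^sub>C Z) = 1"
    and Rr: "\<And>\<zeta>. cmod \<zeta> = 1 \<Longrightarrow> (1 - \<zeta> *\<^sub>C Z) * R \<zeta> = 1" by metis
  have normZ: "norm (Z ^ n) = 1" for n
    by (rule norm_isometry[OF isometry_power[OF Z]])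
  have diff: "norm (R \<zeta> - R \<mu>) \<le> cmod (\<zeta> - \<mu>) * norm (R \<zeta>) * norm (R \<mu>)"
    if "cmod \<zeta> = 1" "cmod \<mu> = 1" for \<zeta> \<mu>
  proof -
    have "R \<zeta> * ((1 - \<mu> *\<^sub>C Z) * R \<mu>) - (R \<zeta> * (1 - \<zeta> *\<^sub>C Z)) * R \<mu> = (\<zeta> - \<mu>) *\<^sub>C (R \<zeta> * Z * R \<mu>)"
      by (simp add: algebra_simps scaleC_mult_left scaleC_mult_right cstar_vs.scale_left_diff_distrib)
    then have "R \<zeta> - R \<mu> = (\<zeta> - \<mu>) *\<^sub>C (R \<zeta> * Z * R \<mu>)"
      using that by (simp add: Rl Rr)
    then have "norm (R \<zeta> - R \<mu>) = cmod (\<zeta> - \<mu>) * norm (R \<zeta> * Z * R \<mu>)"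
      by (simp add: norm_scaleC)
    also have "norm (R \<zeta> * Z * R \<mu>) \<le> norm (R \<zeta>) * norm (R \<mu>)"
      using norm_mult_ineq[of "R \<zeta> * Z" "R \<mu>"] norm_mult_ineq[of "R \<zeta>" Z] normZ[of 1]
      by (simp, meson mult_right_mono norm_ge_zero order_trans)
    finally show ?thesis by (simp add: mult.assoc mult_left_mono)
  qed
  have Rpos: "norm (R \<zeta>) > 0" if "cmod \<zeta> = 1" for \<zeta>
    using Rr[OF that] by auto
  define \<delta> where "\<delta> \<zeta> = 1 / (2 * norm (R \<zeta>))" for \<zeta>
  \<comment> \<open>The radius \<open>\<delta> \<zeta>\<close> absorbs half of \<open>norm (R \<mu>)\<close> in the resolvent identity.\<close>
  have local_bound: "norm (R \<mu>) \<le> 2 * norm (R \<zeta>)"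
    if "cmod \<zeta> = 1" "cmod \<mu> = 1" "\<mu> \<in> ball \<zeta> (\<delta> \<zeta>)" for \<zeta> \<mu>
  proof -
    have "cmod (\<zeta> - \<mu>) * norm (R \<zeta>) \<le> 1 / 2"
      using that Rpos[of \<zeta>] by (simp add: \<delta>_def dist_norm field_simps)
    then have "cmod (\<zeta> - \<mu>) * norm (R \<zeta>) * norm (R \<mu>) \<le> 1 / 2 * norm (R \<mu>)"
      by (rule mult_right_mono) simp
    moreover have "norm (R \<mu>) \<le> norm (R \<zeta>) + norm (R \<zeta> - R \<mu>)"
      using norm_triangle_ineq4[of "R \<zeta>" "R \<zeta> - R \<mu>"] by simp
    ultimately show ?thesis using diff[OF that(1,2)] by simp
  qed
  have "compact (sphere (0::complex) 1)" by simp
  then obtain C where C: "C \<subseteq> sphere (0::complex) 1" "finite C" "sphere 0 1 \<subseteq> (\<Union>\<zeta>\<in>C. ball \<zeta> (\<delta> \<zeta>))"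
    by (rule compactE_image[of _ "sphere 0 1" "\<lambda>\<zeta>. ball \<zeta> (\<delta> \<zeta>)"])
      (use Rpos in \<open>auto simp: \<delta>_def intro!: bexI\<close>)
  define K where "K = (\<Sum>\<zeta>\<in>C. 2 * norm (R \<zeta>))"
  have K: "norm (R \<mu>) \<le> K" if \<mu>: "cmod \<mu> = 1" for \<mu>
  proof -
    obtain \<zeta> where \<zeta>: "\<zeta> \<in> C" "\<mu> \<in> ball \<zeta> (\<delta> \<zeta>)" using C(3) \<mu> by auto
    then have "norm (R \<mu>) \<le> 2 * norm (R \<zeta>)" using local_bound[of \<zeta> \<mu>] C(1) \<mu> by auto
    also have "\<dots> \<le> K" unfolding K_def
      using member_le_sum[of \<zeta> C "\<lambda>\<zeta>. 2 * norm (R \<zeta>)"] \<zeta> C(2) by simp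
    finally show ?thesis .
  qed
  have K0: "0 \<le> K" using order_trans[OF norm_ge_zero K[of 1]] by simp
  have apart: "1 \<le> K * K * cmod (1 - cis (pi / N))" if "N > 0" for N :: nat
  proof -
    define \<omega> where "\<omega> = cis (2 * pi / N)"
    define \<tau> where "\<tau> = cis (pi / N)"
    define S where "S t = (\<Sum>j<N. R (\<omega> ^ j * t))" for t
    have \<omega>: "cmod (\<omega> ^ j) = 1" for j by (simp add: \<omega>_def norm_power)
    have \<tau>: "cmod \<tau> = 1" "\<tau> ^ N = -1"
      using that by (simp_all add: \<tau>_def Complex.DeMoivre)
    have S1: "(1 - Z ^ N) * S 1 = of_nat N"
      using resolvent_average[OF Rr that, where t = 1] by (simp add: S_def \<omega>_def)
    have S\<tau>: "(1 + Z ^ N) * S \<tau> = of_nat N"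
      using resolvent_average[OF Rr that \<tau>(1)]
      by (simp add: S_def \<omega>_def \<tau>(2))
    have commute: "(1 + Z ^ N) * (1 - Z ^ N) = (1 - Z ^ N) * (1 + Z ^ N)"
      by (simp add: algebra_simps)
    have "(1 + Z ^ N) * (1 - Z ^ N) * (S 1 - S \<tau>)
        = (1 + Z ^ N) * (1 - Z ^ N) * S 1 - (1 - Z ^ N) * (1 + Z ^ N) * S \<tau>"
      by (simp only: right_diff_distrib[of _ "S 1" "S \<tau>"] commute)
    also have "\<dots> = (1 + Z ^ N) * ((1 - Z ^ N) * S 1) - (1 - Z ^ N) * ((1 + Z ^ N) * S \<tau>)"
      by (simp only: mult.assoc)
    also have "\<dots> = (2 * real N) *\<^sub>R Z ^ N"
    proof -
      have "Z ^ N * of_nat N = real N *\<^sub>R Z ^ N"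
        by (simp add: scaleR_conv_of_real mult_of_nat_commute)
      then show ?thesis
        unfolding S1 S\<tau> by (simp add: distrib_right left_diff_distrib flip: scaleR_left_distrib)
    qed
    finally have "2 * real N = norm ((1 + Z ^ N) * (1 - Z ^ N) * (S 1 - S \<tau>))"
      by (simp add: normZ)
    also have "\<dots> \<le> norm ((1 + Z ^ N) * (1 - Z ^ N)) * norm (S 1 - S \<tau>)"
      by (rule norm_mult_ineq)
    also have "(1 + Z ^ N) * (1 - Z ^ N) = 1 - Z ^ (N + N)"
      by (simp add: algebra_simps power_add)
    also have "norm (1 - Z ^ (N + N)) * norm (S 1 - S \<tau>) \<le> 2 * norm (S 1 - S \<tau>)"
      using norm_triangle_ineq4[of 1 "Z ^ (N + N)"] normZ[of "N + N"]
      by (intro mult_right_mono) auto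
    finally have "real N \<le> norm (S 1 - S \<tau>)" by simp
    also have "\<dots> \<le> (\<Sum>j<N. norm (R (\<omega> ^ j) - R (\<omega> ^ j * \<tau>)))"
      by (simp add: S_def norm_sum flip: sum_subtractf)
    also have "\<dots> \<le> (\<Sum>j<N. K * K * cmod (1 - \<tau>))"
    proof (rule sum_mono)
      fix j
      have 1: "cmod (\<omega> ^ j * \<tau>) = 1" by (simp add: norm_mult \<omega> \<tau>)
      have "cmod (\<omega> ^ j - \<omega> ^ j * \<tau>) = cmod (\<omega> ^ j) * cmod (1 - \<tau>)"
        by (simp add: algebra_simps flip: norm_mult)
      then have "norm (R (\<omega> ^ j) - R (\<omega> ^ j * \<tau>)) \<le> cmod (1 - \<tau>) * norm (R (\<omega> ^ j)) * norm (R (\<omega> ^ j * \<tau>))"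
        using diff[OF \<omega> 1, of j] by (simp add: \<omega>)
      also have "\<dots> \<le> cmod (1 - \<tau>) * K * K"
        by (intro mult_mono K \<omega> 1) (use K0 in auto)
      finally show "norm (R (\<omega> ^ j) - R (\<omega> ^ j * \<tau>)) \<le> K * K * cmod (1 - \<tau>)"
        by (simp add: mult_ac)
    qed
    finally show ?thesis using that by (simp add: \<tau>_def)
  qed
  have "(\<lambda>N. cis (pi / real N)) \<longlonglongrightarrow> cis 0"
    by (intro tendsto_cis lim_const_over_n)
  then have "(\<lambda>N. K * K * cmod (1 - cis (pi / real N))) \<longlonglongrightarrow> K * K * cmod (1 - cis 0)"
    by (intro tendsto_intros)
  then have "eventually (\<lambda>N. K * K * cmod (1 - cis (pi / real N)) < 1) sequentially"
    by (rule order_tendstoD) simp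
  then have "eventually (\<lambda>N. False) sequentially"
    using eventually_gt_at_top[of 0]
  proof eventually_elim
    case (elim N)
    then show ?case using apart[of N] by linarith
  qed
  then show False by simp
qed

section \<open>Simple algebras\<close>

lemma near_one_right_invertible:
  fixes x :: "'a::{real_normed_algebra_1, banach}"
  assumes "norm (1 - x) < 1"
  shows "\<exists>y. x * y = 1"
proof
  define z where "z = 1 - x"
  have sm: "summable (\<lambda>n. z ^ n)"
    using assms by (intro complete_algebra_summable_geometric) (simp add: z_def)
  have "z * (\<Sum>n. z ^ n) = (\<Sum>n. z ^ Suc n)"
    using suminf_mult[OF sm, of z] by simp
  also have "\<dots> = (\<Sum>n. z ^ n) - 1"
    using suminf_split_head[OF sm] by simp
  finally show "x * (\<Sum>n. z ^ n) = 1"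
    by (simp add: z_def algebra_simps)
qed

lemma ideal_closure_range_mult:
  fixes x :: "'a::cstar_algebra"
  assumes central: "\<And>y. x * y = y * x"
  shows "ideal (closure (range ((*) x))) cstar_univ"
proof (rule idealI)
  interpret ring "cstar_univ :: 'a cstar_ring" by (rule ring_cstar_univ)
  let ?I = "closure (range ((*) x))"
  show "ring (cstar_univ :: 'a cstar_ring)" by (rule ring_cstar_univ)
  have left: "c * a \<in> ?I" if "a \<in> ?I" for a c
  proof -
    have "(\<lambda>a. c * a) ` closure (range ((*) x)) \<subseteq> ?I"
    proof (rule image_closure_subset)
      have "c * (x * y) = x * (c * y)" for y by (metis central mult.assoc)
      then have "(\<lambda>a. c * a) ` range ((*) x) \<subseteq> range ((*) x)" by auto
      then show "(\<lambda>a. c * a) ` range ((*) x) \<subseteq> ?I"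
        using closure_subset by (rule order_trans)
    qed (auto intro!: continuous_intros)
    then show ?thesis using that by blast
  qed
  have right: "a * c \<in> ?I" if "a \<in> ?I" for a c
  proof -
    have "(\<lambda>a. a * c) ` closure (range ((*) x)) \<subseteq> ?I"
    proof (rule image_closure_subset)
      have "(\<lambda>a. a * c) ` range ((*) x) \<subseteq> range ((*) x)" by (auto simp: mult.assoc)
      then show "(\<lambda>a. a * c) ` range ((*) x) \<subseteq> ?I"
        using closure_subset by (rule order_trans)
    qed (auto intro!: continuous_intros)
    then show ?thesis using that by blast
  qed
  have add: "a + b \<in> ?I" if a: "a \<in> ?I" and b: "b \<in> ?I" for a b
  proof -
    obtain f where f: "\<forall>n. f n \<in> range ((*) x)" "f \<longlonglongrightarrow> a"
      using closure_sequential[THEN iffD1, OF a] by blast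
    obtain g where g: "\<forall>n. g n \<in> range ((*) x)" "g \<longlonglongrightarrow> b"
      using closure_sequential[THEN iffD1, OF b] by blast
    have "f n + g n \<in> range ((*) x)" for n
    proof -
      obtain y z where "f n = x * y" "g n = x * z" using f(1) g(1) by (meson imageE)
      then have "f n + g n = x * (y + z)" by (simp add: distrib_left)
      then show ?thesis by simp
    qed
    then show ?thesis
      by (intro closure_sequential[THEN iffD2] exI[of _ "\<lambda>n. f n + g n"] conjI allI
          tendsto_add f(2) g(2))
  qed
  have uminus: "inv\<^bsub>add_monoid cstar_univ\<^esub> a = - a" for a :: 'a
    unfolding a_inv_def[symmetric] by (rule minus_equality) auto
  show "subgroup ?I (add_monoid cstar_univ)"
  proof
    show "\<one>\<^bsub>add_monoid cstar_univ\<^esub> \<in> ?I"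
      using subsetD[OF closure_subset rangeI[of "(*) x" 0]] by simp
    show "inv\<^bsub>add_monoid cstar_univ\<^esub> a \<in> ?I" if "a \<in> ?I" for a
      using left[OF that, of "- 1"] unfolding uminus by simp
  qed (use add in auto)
  show "c \<otimes>\<^bsub>cstar_univ\<^esub> a \<in> ?I" "a \<otimes>\<^bsub>cstar_univ\<^esub> c \<in> ?I" if "a \<in> ?I" for a c
    using left[OF that] right[OF that] by simp_all
qed

text \<open>
  The closed ideal generated by a nonzero central element is everything, so a multiple of that
  element lies at distance less than \<open>1\<close> from the unit and is invertible.
\<close>

lemma central_invertible:
  fixes x :: "'a::cstar_algebra"
  assumes simple: "cstar_simple TYPE('a)" and central: "\<And>y. x * y = y * x" and "x \<noteq> 0"
  shows "\<exists>y. x * y = 1"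
proof -
  let ?I = "closure (range ((*) x))"
  have "x * 1 \<in> ?I"
    by (rule subsetD[OF closure_subset]) (rule rangeI)
  then have "x \<in> ?I" by simp
  then have "?I \<noteq> {0}" using \<open>x \<noteq> 0\<close> by auto
  then have "?I = UNIV"
    using simple ideal_closure_range_mult[OF central] unfolding cstar_simple_def by blast
  then have "1 \<in> ?I" by simp
  then obtain b where "dist (x * b) 1 < 1"
    unfolding closure_approachable by (metis imageE zero_less_one)
  then have "norm (1 - x * b) < 1" by (simp add: dist_norm norm_minus_commute)
  from near_one_right_invertible[OF this] show ?thesis
    by (auto simp: mult.assoc)
qed

lemma central_unitary_scalar:
  fixes Z :: "'a::cstar_algebra"
  assumes simple: "cstar_simple TYPE('a)" and central: "\<And>y. Z * y = y * Z"
    and Z: "star Z * Z = 1"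
  shows "Z \<in> scalars"
proof -
  obtain \<zeta> where \<zeta>: "cmod \<zeta> = 1"
    and not_inv: "\<nexists>R. R * (1 - \<zeta> *\<^sub>C Z) = 1 \<and> (1 - \<zeta> *\<^sub>C Z) * R = 1"
    using unitary_spectrum_nonempty[OF Z] by blast
  have c: "(1 - \<zeta> *\<^sub>C Z) * y = y * (1 - \<zeta> *\<^sub>C Z)" for y
    by (simp add: algebra_simps scaleC_mult_left scaleC_mult_right central)
  then have "1 - \<zeta> *\<^sub>C Z = 0"
    using central_invertible[OF simple c] not_inv by metis
  then have "inverse \<zeta> *\<^sub>C (\<zeta> *\<^sub>C Z) = inverse \<zeta> *\<^sub>C 1" by simp
  moreover have "\<zeta> \<noteq> 0" using \<zeta> by auto
  ultimately have "Z = inverse \<zeta> *\<^sub>C 1" by simp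
  then show ?thesis unfolding scalars_def by blast
qed

section \<open>Finite averages\<close>

text \<open>
  Averages come with weights indexed by \<open>{1..n}\<close>; here any finite index set is allowed.
\<close>

lemma Ave_finite_index:
  assumes "finite I" "\<And>i. i \<in> I \<Longrightarrow> U i \<in> V" "\<And>i. i \<in> I \<Longrightarrow> r i > 0" "sum r I = 1"
  shows "(\<lambda>A. \<Sum>i\<in>I. r i *\<^sub>R (U i * A * star (U i))) \<in> Ave V"
proof -
  obtain h where h: "bij_betw h {1..card I} I"
    using ex_bij_betw_nat_finite_1[OF \<open>finite I\<close>] by blast
  have "I \<noteq> {}" using assms(4) by auto
  then have "1 \<le> card I" using \<open>finite I\<close> by (simp add: Suc_le_eq card_gt_0_iff)
  moreover have "U (h i) \<in> V \<and> r (h i) > 0" if "i \<in> {1..card I}" for i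
    using assms bij_betwE[OF h] that by blast
  moreover have "(\<Sum>i=1..card I. r (h i)) = 1"
    using sum.reindex_bij_betw[OF h, of r] assms(4) by simp
  moreover have "(\<lambda>A. \<Sum>i\<in>I. r i *\<^sub>R (U i * A * star (U i)))
      = (\<lambda>A. \<Sum>i=1..card I. r (h i) *\<^sub>R (U (h i) * A * star (U (h i))))"
    by (rule ext, rule sum.reindex_bij_betw[OF h, symmetric])
  ultimately show ?thesis
    unfolding Ave_def by (intro CollectI exI[of _ "card I"] exI[of _ "\<lambda>i. r (h i)"] exI[of _ "\<lambda>i. U (h i)"]) auto
qed

text \<open>
  The characters of a cyclic group, transported to a finite set.  Averaging over them will remove
  the off-diagonal entries of a matrix.
\<close>

lemma ex_orthogonal_phases:
  fixes S :: "'b set"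
  assumes "finite S"
  shows "\<exists>\<eta> :: nat \<Rightarrow> 'b \<Rightarrow> complex. \<forall>e\<in>S. \<forall>f\<in>S.
           (\<Sum>a<card S. \<eta> a e * cnj (\<eta> a f)) = (if e = f then of_nat (card S) else 0) \<and>
           (\<forall>a. \<eta> a e * cnj (\<eta> a e) = 1)"
proof -
  obtain h where "bij_betw h S {0..<card S}" using ex_bij_betw_finite_nat[OF assms] by blast
  then have inj: "inj_on h S" and lt: "\<And>e. e \<in> S \<Longrightarrow> h e < card S"
    by (auto simp: bij_betw_def)
  define \<omega> where "\<omega> = cis (2 * pi / card S)"
  have "\<omega> * cnj \<omega> = 1" by (simp add: \<omega>_def cis_cnj cis_mult)
  then have unit: "\<omega> ^ n * cnj (\<omega> ^ n) = 1" for n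
    by (simp flip: power_mult_distrib)
  show ?thesis
  proof (intro exI[of _ "\<lambda>a e. \<omega> ^ (a * h e)"] ballI conjI allI unit)
    fix e f assume ef: "e \<in> S" "f \<in> S"
    show "(\<Sum>a<card S. \<omega> ^ (a * h e) * cnj (\<omega> ^ (a * h f))) = (if e = f then of_nat (card S) else 0)"
      unfolding \<omega>_def roots_of_unity_orthogonal[OF lt[OF ef(1)] lt[OF ef(2)]]
      using inj_on_eq_iff[OF inj ef] by simp
  qed
qed

text \<open>
  The translations of a cyclic group, transported to a finite set.  Averaging over them will make
  all diagonal entries of a diagonal matrix equal.
\<close>

lemma ex_latin_square:
  fixes S :: "'b set"
  assumes "finite S"
  shows "\<exists>\<sigma> :: nat \<Rightarrow> 'b \<Rightarrow> 'b. (\<forall>b<card S. bij_betw (\<sigma> b) S S) \<and>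
           (\<forall>e\<in>S. bij_betw (\<lambda>b. \<sigma> b e) {..<card S} S)"
proof -
  define N where "N = card S"
  obtain h where h: "bij_betw h {0..<N} S" using ex_bij_betw_nat_finite[OF assms] N_def by blast
  obtain k where k: "bij_betw k S {0..<N}" using ex_bij_betw_finite_nat[OF assms] N_def by blast
  have shift: "bij_betw (\<lambda>x. (x + b) mod N) {0..<N} {0..<N}" for b
  proof -
    have "inj_on (\<lambda>x. (x + b) mod N) {0..<N}"
    proof (rule linorder_inj_onI)
      fix x y assume "x < y" "x \<in> {0..<N}" "y \<in> {0..<N}"
      then show "(x + b) mod N \<noteq> (y + b) mod N"
        using mod_eq_dvd_iff_nat[of "x + b" "y + b" N] nat_dvd_not_less[of "y - x" N] by auto
    qed auto
    moreover have "(\<lambda>x. (x + b) mod N) ` {0..<N} \<subseteq> {0..<N}" by auto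
    ultimately show ?thesis by (simp add: bij_betw_def endo_inj_surj)
  qed
  define \<sigma> where "\<sigma> b e = h ((k e + b) mod N)" for b e
  have "bij_betw (\<sigma> b) S S" for b
    using bij_betw_trans[OF bij_betw_trans[OF k shift[of b]] h] by (simp add: \<sigma>_def[abs_def] o_def)
  moreover have "bij_betw (\<lambda>b. \<sigma> b e) {..<N} S" for e
    using bij_betw_trans[OF shift[of "k e"] h]
    by (simp add: \<sigma>_def[abs_def] o_def add.commute atLeast0LessThan)
  ultimately show ?thesis unfolding N_def by blast
qed

section \<open>Cuntz-type representations\<close>

locale cuntz_family = single_vertex_kgraph d
  for d :: "'l::monoid_mult \<Rightarrow> nat ^ 'k" +
  fixes s :: "'l \<Rightarrow> 'a::cstar_algebra"
  assumes rep: "cuntz_rep d cstar_univ s"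
begin

abbreviation E :: "'k \<Rightarrow> 'l set" where "E \<equiv> edges d"

abbreviation m :: "'k \<Rightarrow> nat" where "m i \<equiv> card (E i)"

abbreviation g :: "'l list \<Rightarrow> 'a" where "g \<equiv> gen_word s"

lemma star_gen_gen:
  assumes "e \<in> E i" "f \<in> E i"
  shows "star (s e) * s f = (if e = f then 1 else 0)"
  using rep assms unfolding cuntz_rep_def cuntz_tuple_def by simp

lemma star_gen_gen_mult:
  assumes "e \<in> E i" "f \<in> E i"
  shows "star (s e) * (s f * x) = (if e = f then x else 0)"
  by (simp add: star_gen_gen[OF assms] flip: mult.assoc)

lemma sum_gen_star: "(\<Sum>e\<in>E i. s e * star (s e)) = 1"
proof -
  have "(\<Oplus>\<^bsub>cstar_univ\<^esub>e\<in>E i. s e * star (s e)) = 1"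
    using rep unfolding cuntz_rep_def cuntz_tuple_def by simp
  then show ?thesis by (simp add: finite_edges)
qed

lemma card_pos: "m i > 0"
proof -
  have "E i \<noteq> {}" using sum_gen_star[of i] by auto
  then show ?thesis by (simp add: card_gt_0_iff finite_edges)
qed

lemma norm_gen: "e \<in> E i \<Longrightarrow> norm (s e) = 1"
  by (rule norm_isometry) (simp add: star_gen_gen)

lemma edges_disjoint: "e \<in> E i \<Longrightarrow> e \<in> E j \<Longrightarrow> i = j"
  unfolding edges_def by (auto simp: axis_eq_axis)

lemma edge_factorization_unique:
  assumes "e \<in> E i" "e' \<in> E i" "f \<in> E j" "f' \<in> E j" "e * f = e' * f'"
  shows "e = e' \<and> f = f'"
proof -
  define P where "P = (\<lambda>(p, q). e * f = p * q \<and> d p = axis i 1 \<and> d q = axis j 1)"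
  have "\<exists>!x. P x"
    unfolding P_def by (rule factorization) (use assms in \<open>simp add: degree_mult edges_def\<close>)
  moreover have "P (e, f)" "P (e', f')" using assms by (simp_all add: P_def edges_def)
  ultimately have "(e, f) = (e', f')" by blast
  then show ?thesis by simp
qed

lemma gen_relation:
  assumes "i \<noteq> j" "e \<in> E i" "e' \<in> E i" "f \<in> E j" "f' \<in> E j" "e * f = f' * e'"
  shows "s e * s f = s f' * s e'"
proof -
  have "\<forall>i j. \<forall>e\<in>E i. \<forall>e'\<in>E i. \<forall>f\<in>E j. \<forall>f'\<in>E j.
      i \<noteq> j \<and> e * f = f' * e' \<longrightarrow> s e * s f = s f' * s e'"
    using rep unfolding cuntz_rep_def by simp
  then show ?thesis using assms by blast
qed

lemma swap_edges:
  assumes "i \<noteq> j" "e \<in> E i" "f \<in> E j"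
  shows "\<exists>f'\<in>E j. \<exists>e'\<in>E i. e * f = f' * e' \<and> s e * s f = s f' * s e'"
proof -
  define P where "P = (\<lambda>(p, q). e * f = p * q \<and> d p = axis j 1 \<and> d q = axis i 1)"
  have "\<exists>!x. P x"
    unfolding P_def by (rule factorization) (use assms in \<open>simp add: degree_mult edges_def add.commute\<close>)
  then obtain f' e' where "P (f', e')" by auto
  then have fe: "e * f = f' * e'" "f' \<in> E j" "e' \<in> E i"
    by (simp_all add: P_def edges_def)
  have "s e * s f = s f' * s e'"
    by (rule gen_relation[OF assms(1,2) fe(3) assms(3) fe(2,1)])
  then show ?thesis using fe by blast
qed

section \<open>Compression\<close>

definition compress :: "'k \<Rightarrow> 'a \<Rightarrow> 'a" where
  "compress i A = (1 / real (m i)) *\<^sub>R (\<Sum>e\<in>E i. star (s e) * A * s e)"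

lemma compress_add: "compress i (A + B) = compress i A + compress i B"
  by (simp add: compress_def algebra_simps sum.distrib)

lemma compress_diff: "compress i (A - B) = compress i A - compress i B"
  by (simp add: compress_def algebra_simps sum_subtractf)

lemma compress_scaleC: "compress i (c *\<^sub>C A) = c *\<^sub>C compress i A"
  by (simp add: compress_def scaleC_mult_left scaleC_mult_right scaleR_scaleC_commute
      flip: scaleC_sum_right)

lemma compress_one: "compress i 1 = 1"
proof -
  have "(\<Sum>e\<in>E i. star (s e) * 1 * s e) = real (m i) *\<^sub>R 1"
    by (simp add: star_gen_gen scaleR_conv_of_real)
  then show ?thesis unfolding compress_def using card_pos[of i] by simp
qed

lemma compress_star: "compress i (star A) = star (compress i A)"
  by (simp add: compress_def star_scaleR star_sum star_mult star_star mult.assoc)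

lemma norm_compress: "norm (compress i A) \<le> norm A"
proof -
  have "norm (star (s e) * A * s e) \<le> norm A" if "e \<in> E i" for e
    using norm_mult_ineq[of "star (s e) * A" "s e"] norm_mult_ineq[of "star (s e)" A]
    by (simp add: norm_gen[OF that])
  then have "norm (\<Sum>e\<in>E i. star (s e) * A * s e) \<le> real (m i) * norm A"
    by (rule sum_norm_bound)
  then show ?thesis
    using card_pos[of i] by (simp add: compress_def field_simps)
qed

text \<open>
  For two colours both sides average \<open>star x * A * x\<close> over the products \<open>x\<close> of one generator of each
  colour, and the factorization property matches the two orders of multiplication.
\<close>

lemma compress_commute: "compress i (compress j A) = compress j (compress i A)"
proof (cases "i = j")
  case False
  define F where "F x = star x * A * x" for x
  have double: "compress p (compress q A)
      = (1 / (real (m p) * real (m q))) *\<^sub>R (\<Sum>(e, f)\<in>E p \<times> E q. F (s f * s e))" for p q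
  proof -
    have "star (s e) * compress q A * s e = (1 / real (m q)) *\<^sub>R (\<Sum>f\<in>E q. F (s f * s e))" for e
      by (simp add: compress_def F_def star_mult mult.assoc sum_distrib_left sum_distrib_right)
    then have "compress p (compress q A)
        = (1 / real (m p)) *\<^sub>R (\<Sum>e\<in>E p. (1 / real (m q)) *\<^sub>R (\<Sum>f\<in>E q. F (s f * s e)))"
      by (simp only: compress_def[of p "compress q A"])
    then show ?thesis
      by (simp add: sum.cartesian_product flip: scaleR_sum_right)
  qed
  have "\<forall>x\<in>E i \<times> E j. \<exists>y. y \<in> E i \<times> E j \<and> fst x * snd x = snd y * fst y
      \<and> s (fst x) * s (snd x) = s (snd y) * s (fst y)"
  proof
    fix x assume "x \<in> E i \<times> E j"
    then obtain f' e' where "f' \<in> E j" "e' \<in> E i" "fst x * snd x = f' * e'"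
        "s (fst x) * s (snd x) = s f' * s e'"
      using swap_edges[OF False, of "fst x" "snd x"] by (auto simp: mem_Times_iff)
    then show "\<exists>y. y \<in> E i \<times> E j \<and> fst x * snd x = snd y * fst y
        \<and> s (fst x) * s (snd x) = s (snd y) * s (fst y)"
      by (intro exI[of _ "(e', f')"]) simp
  qed
  from bchoice[OF this] obtain h where "\<forall>x\<in>E i \<times> E j. h x \<in> E i \<times> E j \<and> fst x * snd x = snd (h x) * fst (h x)
      \<and> s (fst x) * s (snd x) = s (snd (h x)) * s (fst (h x))" ..
  then have h: "\<And>x. x \<in> E i \<times> E j \<Longrightarrow> h x \<in> E i \<times> E j"
      "\<And>x. x \<in> E i \<times> E j \<Longrightarrow> fst x * snd x = snd (h x) * fst (h x)"
      "\<And>x. x \<in> E i \<times> E j \<Longrightarrow> s (fst x) * s (snd x) = s (snd (h x)) * s (fst (h x))"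
    by blast+
  have "inj_on h (E i \<times> E j)"
  proof (rule inj_onI)
    fix x y assume xy: "x \<in> E i \<times> E j" "y \<in> E i \<times> E j" "h x = h y"
    have "fst x * snd x = fst y * snd y"
      using h(2)[OF xy(1)] h(2)[OF xy(2)] xy(3) by simp
    then have "fst x = fst y \<and> snd x = snd y"
      using xy(1,2) by (intro edge_factorization_unique[of _ i _ _ j]) (auto simp: mem_Times_iff)
    then show "x = y" by (simp add: prod_eq_iff)
  qed
  moreover have "h ` (E i \<times> E j) \<subseteq> E i \<times> E j" using h(1) by blast
  ultimately have bij: "bij_betw h (E i \<times> E j) (E i \<times> E j)"
    unfolding bij_betw_def by (simp add: endo_inj_surj finite_edges)
  have "(\<Sum>(f, e)\<in>E j \<times> E i. F (s e * s f)) = (\<Sum>x\<in>E i \<times> E j. F (s (fst x) * s (snd x)))"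
    by (rule sum.reindex_bij_witness[of _ prod.swap prod.swap]) auto
  also have "\<dots> = (\<Sum>x\<in>E i \<times> E j. F (s (snd (h x)) * s (fst (h x))))"
    by (rule sum.cong) (simp_all add: h(3))
  also have "\<dots> = (\<Sum>x\<in>E i \<times> E j. F (s (snd x) * s (fst x)))"
    by (rule sum.reindex_bij_betw[OF bij, of "\<lambda>x. F (s (snd x) * s (fst x))"])
  also have "\<dots> = (\<Sum>(e, f)\<in>E i \<times> E j. F (s f * s e))"
    by (simp add: case_prod_beta)
  finally show ?thesis
    unfolding double by (simp only: mult.commute[of "real (m j)"])
next
  case True
  show ?thesis unfolding True by (rule refl)
qed

abbreviation compress_word :: "'k list \<Rightarrow> 'a \<Rightarrow> 'a" where
  "compress_word \<equiv> fold compress"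

lemma compress_word_add: "compress_word w (A + B) = compress_word w A + compress_word w B"
  by (induction w arbitrary: A B) (simp_all add: compress_add)

lemma compress_word_diff: "compress_word w (A - B) = compress_word w A - compress_word w B"
  by (induction w arbitrary: A B) (simp_all add: compress_diff)

lemma compress_word_scaleC: "compress_word w (c *\<^sub>C A) = c *\<^sub>C compress_word w A"
  by (induction w arbitrary: A) (simp_all add: compress_scaleC)

lemma compress_word_scaleR: "compress_word w (r *\<^sub>R A) = r *\<^sub>R compress_word w A"
  by (simp add: scaleR_eq_scaleC compress_word_scaleC)

lemma compress_word_one: "compress_word w 1 = 1"
  by (induction w) (simp_all add: compress_one)

lemma compress_word_star: "compress_word w (star A) = star (compress_word w A)"
  by (induction w arbitrary: A) (simp_all add: compress_star)

lemma norm_compress_word: "norm (compress_word w A) \<le> norm A"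
proof (induction w arbitrary: A)
  case (Cons i w)
  show ?case using Cons[of "compress i A"] norm_compress[of i A] by simp
qed simp

lemma compress_word_commute:
  "compress_word v (compress_word w A) = compress_word w (compress_word v A)"
proof -
  have single: "compress i (compress_word w A) = compress_word w (compress i A)" for i w A
  proof (induction w arbitrary: A)
    case (Cons j w)
    show ?case using Cons[of "compress j A"] by (simp only: fold_simps compress_commute[of i j])
  qed simp
  show ?thesis
  proof (induction v arbitrary: A)
    case (Cons i v)
    show ?case using Cons[of "compress i A"] by (simp only: fold_simps single)
  qed simp
qed

section \<open>Elements compressed to a scalar\<close>

text \<open>
  One word for each \<open>\<epsilon>\<close> is enough and no limit along a net of words is taken: compressions commute
  and do not increase the distance to a scalar, so a word that is good for \<open>\<epsilon>\<close> can be extended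
  freely.
\<close>

definition compresses_to :: "'a \<Rightarrow> complex \<Rightarrow> bool" where
  "compresses_to A c \<longleftrightarrow> (\<forall>\<epsilon>>0. \<exists>w. norm (compress_word w A - c *\<^sub>C 1) < \<epsilon>)"

lemma compresses_to_of_compress:
  assumes "compresses_to (compress i A) c"
  shows "compresses_to A c"
  unfolding compresses_to_def
proof (intro allI impI)
  fix \<epsilon> :: real assume "\<epsilon> > 0"
  then obtain w where "norm (compress_word w (compress i A) - c *\<^sub>C 1) < \<epsilon>"
    using assms unfolding compresses_to_def by blast
  then have "norm (compress_word (i # w) A - c *\<^sub>C 1) < \<epsilon>" by simp
  then show "\<exists>w. norm (compress_word w A - c *\<^sub>C 1) < \<epsilon>" by blast
qed

lemma compress_word_near_scalar:
  assumes "norm (compress_word w A - c *\<^sub>C 1) < \<epsilon>"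
  shows "norm (compress_word v (compress_word w A) - c *\<^sub>C 1) < \<epsilon>"
proof -
  have eq: "compress_word v (compress_word w A) - c *\<^sub>C 1 = compress_word v (compress_word w A - c *\<^sub>C 1)"
    by (simp add: compress_word_diff compress_word_scaleC compress_word_one)
  show ?thesis
    unfolding eq using norm_compress_word assms by (rule order.strict_trans1)
qed

text \<open>
  Compressing by a good word for \<open>A\<close> and then by a good word for \<open>B\<close> is good for both.
\<close>

lemma compresses_to_add:
  assumes "compresses_to A a" "compresses_to B b"
  shows "compresses_to (A + B) (a + b)"
  unfolding compresses_to_def
proof (intro allI impI)
  fix \<epsilon> :: real assume "\<epsilon> > 0"
  then have "\<epsilon> / 2 > 0" by simp
  then obtain v w where v: "norm (compress_word v A - a *\<^sub>C 1) < \<epsilon> / 2"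
    and w: "norm (compress_word w B - b *\<^sub>C 1) < \<epsilon> / 2"
    using assms unfolding compresses_to_def by blast
  have "compress_word (v @ w) (A + B) - (a + b) *\<^sub>C 1
      = (compress_word w (compress_word v A) - a *\<^sub>C 1) + (compress_word v (compress_word w B) - b *\<^sub>C 1)"
    by (simp add: compress_word_add scaleC_add_left compress_word_commute[of v w])
  then have "norm (compress_word (v @ w) (A + B) - (a + b) *\<^sub>C 1) < \<epsilon> / 2 + \<epsilon> / 2"
    using norm_add_less[OF compress_word_near_scalar[OF v] compress_word_near_scalar[OF w]] by simp
  then show "\<exists>w. norm (compress_word w (A + B) - (a + b) *\<^sub>C 1) < \<epsilon>"
    by (intro exI[of _ "v @ w"]) simp
qed

lemma compresses_to_scaleC:
  assumes "compresses_to A a"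
  shows "compresses_to (c *\<^sub>C A) (c * a)"
  unfolding compresses_to_def
proof (intro allI impI)
  fix \<epsilon> :: real assume "\<epsilon> > 0"
  have pos: "cmod c + 1 > 0" by (simp add: add_nonneg_pos)
  then have "\<epsilon> / (cmod c + 1) > 0" using \<open>\<epsilon> > 0\<close> by simp
  then obtain w where w: "norm (compress_word w A - a *\<^sub>C 1) < \<epsilon> / (cmod c + 1)"
    using assms unfolding compresses_to_def by blast
  have "compress_word w (c *\<^sub>C A) - (c * a) *\<^sub>C 1 = c *\<^sub>C (compress_word w A - a *\<^sub>C 1)"
    by (simp add: compress_word_scaleC cstar_vs.scale_right_diff_distrib)
  then have "norm (compress_word w (c *\<^sub>C A) - (c * a) *\<^sub>C 1) = cmod c * norm (compress_word w A - a *\<^sub>C 1)"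
    by (simp add: norm_scaleC)
  also have "\<dots> \<le> cmod c * (\<epsilon> / (cmod c + 1))"
    using w by (intro mult_left_mono) auto
  also have "\<dots> < \<epsilon>"
    using \<open>\<epsilon> > 0\<close> pos by (simp add: field_simps)
  finally show "\<exists>w. norm (compress_word w (c *\<^sub>C A) - (c * a) *\<^sub>C 1) < \<epsilon>" by blast
qed

lemma compresses_to_star:
  assumes "compresses_to A a"
  shows "compresses_to (star A) (cnj a)"
proof -
  have "norm (compress_word w (star A) - cnj a *\<^sub>C 1) = norm (compress_word w A - a *\<^sub>C 1)" for w
    using norm_star[of "compress_word w A - a *\<^sub>C 1"]
    by (simp add: compress_word_star star_diff star_scaleC)
  then show ?thesis using assms by (simp add: compresses_to_def)
qed

lemma compresses_to_zero: "compresses_to 0 0"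
  unfolding compresses_to_def by (intro allI impI exI[of _ "[]"]) simp

lemma compresses_to_one: "compresses_to 1 1"
  unfolding compresses_to_def by (intro allI impI exI[of _ "[]"]) simp

text \<open>
  A limit point can be compressed into every neighbourhood of the scalars.  The scalars
  belonging to two such compressions are both close to the joint compression, so they form a Cauchy
  sequence, whose limit serves for \<open>A\<close>.
\<close>

lemma ex_compresses_to_closure:
  assumes "A \<in> closure {B. \<exists>c. compresses_to B c}"
  shows "\<exists>c. compresses_to A c"
proof -
  have near: "\<exists>w c. norm (compress_word w A - c *\<^sub>C 1) < \<epsilon>" if eps: "\<epsilon> > 0" for \<epsilon>
  proof -
    obtain B where "B \<in> {B. \<exists>c. compresses_to B c}" and dist: "dist B A < \<epsilon> / 2"
      using assms[unfolded closure_approachable] half_gt_zero[OF eps] by blast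
    then obtain b where B: "compresses_to B b" by blast
    obtain w where w: "norm (compress_word w B - b *\<^sub>C 1) < \<epsilon> / 2"
      using B half_gt_zero[OF eps] unfolding compresses_to_def by blast
    have eq: "compress_word w A - b *\<^sub>C 1 = compress_word w (A - B) + (compress_word w B - b *\<^sub>C 1)"
      by (simp add: compress_word_diff)
    have "norm (A - B) < \<epsilon> / 2" using dist by (simp add: dist_norm norm_minus_commute)
    with norm_compress_word[of w "A - B"] have "norm (compress_word w (A - B)) < \<epsilon> / 2"
      by (rule order.strict_trans1)
    then have "norm (compress_word w A - b *\<^sub>C 1) < \<epsilon> / 2 + \<epsilon> / 2"
      unfolding eq using w by (rule norm_add_less)
    then show ?thesis by auto
  qed
  have "\<forall>n::nat. \<exists>w c. norm (compress_word w A - c *\<^sub>C 1) < inverse (real (Suc n))"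
    using near by simp
  then obtain w c where wc: "\<And>n. norm (compress_word (w n) A - c n *\<^sub>C 1) < inverse (real (Suc n))"
    by metis
  have dist_c: "dist (c n) (c k) < inverse (real (Suc n)) + inverse (real (Suc k))" for n k
  proof -
    \<comment> \<open>\<open>?D\<close> is the joint compression, close to both \<open>c n\<close> and \<open>c k\<close>.\<close>
    let ?D = "compress_word (w n) (compress_word (w k) A)"
    have "norm (?D - c k *\<^sub>C 1) < inverse (real (Suc k))"
      using compress_word_near_scalar[OF wc[of k], of "w n"] .
    moreover have "norm (?D - c n *\<^sub>C 1) < inverse (real (Suc n))"
      using compress_word_near_scalar[OF wc[of n], of "w k"] by (simp only: compress_word_commute)
    ultimately have "norm ((?D - c k *\<^sub>C 1) - (?D - c n *\<^sub>C 1)) < inverse (real (Suc n)) + inverse (real (Suc k))"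
      using norm_triangle_ineq4[of "?D - c k *\<^sub>C 1" "?D - c n *\<^sub>C 1"] by linarith
    then show ?thesis
      by (simp add: dist_norm flip: cstar_vs.scale_left_diff_distrib)
  qed
  have "Cauchy c"
  proof (rule metric_CauchyI)
    fix e :: real assume "e > 0"
    then obtain N where N: "inverse (real (Suc N)) < e / 2"
      using reals_Archimedean[of "e / 2"] by auto
    have "dist (c a) (c b) < e" if "a \<ge> N" "b \<ge> N" for a b
    proof -
      have "inverse (real (Suc a)) \<le> inverse (real (Suc N))" "inverse (real (Suc b)) \<le> inverse (real (Suc N))"
        using that by (auto intro!: le_imp_inverse_le)
      then show ?thesis using dist_c[of a b] N by linarith
    qed
    then show "\<exists>M. \<forall>m\<ge>M. \<forall>n\<ge>M. dist (c m) (c n) < e" by blast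
  qed
  then obtain z where z: "c \<longlonglongrightarrow> z" using Cauchy_convergent convergentD by blast
  have "compresses_to A z"
    unfolding compresses_to_def
  proof (intro allI impI)
    fix \<epsilon> :: real assume "\<epsilon> > 0"
    then have e2: "\<epsilon> / 2 > 0" by simp
    have "eventually (\<lambda>n. inverse (real (Suc n)) < \<epsilon> / 2) sequentially"
      by (rule order_tendstoD(2)[OF LIMSEQ_inverse_real_of_nat e2])
    moreover have "eventually (\<lambda>n. dist (c n) z < \<epsilon> / 2) sequentially"
      by (rule tendstoD[OF z e2])
    ultimately have "eventually (\<lambda>n. inverse (real (Suc n)) < \<epsilon> / 2 \<and> dist (c n) z < \<epsilon> / 2) sequentially"
      by eventually_elim simp
    then obtain n where n: "inverse (real (Suc n)) < \<epsilon> / 2" "dist (c n) z < \<epsilon> / 2"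
      using eventually_happens'[OF sequentially_bot] by blast
    have eq: "compress_word (w n) A - z *\<^sub>C 1 = (compress_word (w n) A - c n *\<^sub>C 1) + (c n - z) *\<^sub>C 1"
      by (simp add: cstar_vs.scale_left_diff_distrib)
    have "norm (compress_word (w n) A - z *\<^sub>C 1) \<le> norm (compress_word (w n) A - c n *\<^sub>C 1) + norm ((c n - z) *\<^sub>C (1::'a))"
      unfolding eq by (rule norm_triangle_ineq)
    then show "\<exists>w. norm (compress_word w A - z *\<^sub>C 1) < \<epsilon>"
      using wc[of n] n by (intro exI[of _ "w n"]) (simp add: dist_norm)
  qed
  then show ?thesis by blast
qed

section \<open>Amplification and averages by unitaries\<close>

definition amplify :: "'k \<Rightarrow> 'a \<Rightarrow> 'a" where
  "amplify i A = (\<Sum>e\<in>E i. s e * A * star (s e))"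

lemma amplify_one: "amplify i 1 = 1"
  by (simp add: amplify_def sum_gen_star)

lemma bounded_linear_amplify: "bounded_linear (amplify i)"
  unfolding amplify_def
  by (intro bounded_linear_sum bounded_linear_compose[OF bounded_linear_mult_left]
      bounded_linear_mult_right)

lemma amplify_hom: "amplify i (star x * x) = star (amplify i x) * amplify i x"
proof -
  have "star (amplify i x) * amplify i x
      = (\<Sum>e\<in>E i. \<Sum>f\<in>E i. s e * (star x * (star (s e) * (s f * (x * star (s f))))))"
    by (simp add: amplify_def star_sum star_mult star_star sum_product mult.assoc)
  also have "\<dots> = (\<Sum>e\<in>E i. \<Sum>f\<in>E i. if e = f then s e * (star x * (x * star (s e))) else 0)"
    by (intro sum.cong refl) (simp add: star_gen_gen_mult)
  also have "\<dots> = amplify i (star x * x)"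
    by (simp add: finite_edges amplify_def mult.assoc)
  finally show ?thesis ..
qed

lemma norm_amplify: "norm (amplify i x) \<le> norm x"
  using bounded_star_hom_contractive[of "amplify i" x] bounded_linear_amplify[of i] amplify_hom[of i]
  by metis

lemma linear_amplify: "linear (amplify i)"
  by (rule bounded_linear.linear[OF bounded_linear_amplify])

lemma amplify_diff: "amplify i (x - y) = amplify i x - amplify i y"
  by (rule linear_diff[OF linear_amplify])

lemma amplify_scaleR: "amplify i (r *\<^sub>R x) = r *\<^sub>R amplify i x"
  by (rule linear_scale[OF linear_amplify])

lemma amplify_scaleC: "amplify i (c *\<^sub>C x) = c *\<^sub>C amplify i x"
  by (simp add: amplify_def scaleC_mult_left scaleC_mult_right scaleC_sum_right)

abbreviation amplify_word :: "'k list \<Rightarrow> 'a \<Rightarrow> 'a" where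
  "amplify_word \<equiv> foldr amplify"

lemma norm_amplify_word_diff_scalar: "norm (amplify_word w x - c *\<^sub>C 1) \<le> norm (x - c *\<^sub>C 1)"
proof (induction w)
  case (Cons i w)
  have eq: "amplify_word (i # w) x - c *\<^sub>C 1 = amplify i (amplify_word w x - c *\<^sub>C 1)"
    by (simp add: amplify_diff amplify_scaleC amplify_one)
  show ?case unfolding eq using norm_amplify Cons by (rule order_trans)
qed simp

text \<open>
  Prefixing one edge of the same colour to both words of a monomial keeps their degrees equal.
  This puts the amplified unitaries below into \<open>\<X>\<^sub>0\<close> directly, without multiplying
  two general elements of \<open>\<X>\<^sub>0\<close>.
\<close>

lemma X0_edge_sandwich:
  assumes x: "x \<in> X0 d s" and e: "e \<in> E i" and f: "f \<in> E i"
  shows "s e * x * star (s f) \<in> X0 d s"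
proof -
  have sub: "cstar_vs.subspace {x. s e * x * star (s f) \<in> X0 d s}"
    unfolding X0_def
    by (intro cstar_vs.subspaceI)
      (auto simp: distrib_left distrib_right scaleC_mult_left scaleC_mult_right
        cstar_vs.span_zero intro: cstar_vs.span_add cstar_vs.span_scale)
  have "X0 d s \<subseteq> {x. s e * x * star (s f) \<in> X0 d s}"
    unfolding X0_def[of d s] 
  proof (rule cstar_vs.span_minimal[OF _ sub[unfolded X0_def]], safe)
    fix u v assume uv: "set u \<subseteq> all_edges d" "set v \<subseteq> all_edges d" "d (prod_list u) = d (prod_list v)"
    have "s e * (g u * star (g v)) * star (s f) = g (e # u) * star (g (f # v))"
      by (simp add: gen_word_def star_mult mult.assoc)
    moreover have "set (e # u) \<subseteq> all_edges d" "set (f # v) \<subseteq> all_edges d"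
      using e f uv by (auto simp: all_edges_def)
    moreover have "d (prod_list (e # u)) = d (prod_list (f # v))"
      using e f uv by (simp add: degree_mult edges_def)
    ultimately show "s e * (g u * star (g v)) * star (s f) \<in> cstar_vs.span
        {g u * star (g v) | u v. set u \<subseteq> all_edges d \<and> set v \<subseteq> all_edges d \<and> d (prod_list u) = d (prod_list v)}"
      by (intro cstar_vs.span_base) blast
  qed
  then show ?thesis using x by blast
qed

lemma one_in_X0: "1 \<in> X0 d s"
  unfolding X0_def by (intro cstar_vs.span_base CollectI exI[of _ "[]"]) (simp add: gen_word_def)

lemma id_in_Ave_X0: "(\<lambda>A. A) \<in> Ave (unitaries (X0 d s))"
  using Ave_finite_index[of "{()}" "\<lambda>_. 1" "unitaries (X0 d s)" "\<lambda>_. 1"] one_in_X0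
  by (simp add: unitaries_def)

text \<open>
  Each unitary \<open>U\<close> used by \<open>\<alpha>\<close> is replaced by the block matrices
  \<open>\<Sum>\<^sub>e \<eta>\<^sub>a(e) s\<^bsub>\<sigma>(b,e)\<^esub> U s\<^sub>e\<^sup>*\<close>, with \<open>a\<close> ranging over the characters and \<open>b\<close> over the
  translations.  The average over \<open>a\<close> keeps the diagonal blocks \<open>U s\<^sub>e\<^sup>* A s\<^sub>e U\<^sup>*\<close>, and the average
  over \<open>b\<close> spreads each of them evenly over all diagonal positions, which amounts to amplifying
  \<open>U (compress i A) U\<^sup>*\<close>.
\<close>

lemma amplify_Ave_compress:
  assumes "\<alpha> \<in> Ave (unitaries (X0 d s))"
  shows "(\<lambda>A. amplify i (\<alpha> (compress i A))) \<in> Ave (unitaries (X0 d s))"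
proof -
  obtain n :: nat and r :: "nat \<Rightarrow> real" and U
    where rU: "\<forall>l\<in>{1..n}. U l \<in> unitaries (X0 d s) \<and> r l > 0"
    and sum_r: "(\<Sum>l=1..n. r l) = 1"
    and \<alpha>: "\<alpha> = (\<lambda>A. \<Sum>l=1..n. r l *\<^sub>R (U l * A * star (U l)))"
    using assms unfolding Ave_def by blast
  have U: "U l \<in> unitaries (X0 d s)" and r: "r l > 0" if "l \<in> {1..n}" for l
    using rU that by auto
  obtain \<eta> where \<eta>: "\<And>e f. e \<in> E i \<Longrightarrow> f \<in> E i \<Longrightarrow>
        (\<Sum>a<m i. \<eta> a e * cnj (\<eta> a f)) = (if e = f then of_nat (m i) else 0)"
    and \<eta>1: "\<And>a e. e \<in> E i \<Longrightarrow> \<eta> a e * cnj (\<eta> a e) = 1"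
    using ex_orthogonal_phases[OF finite_edges[of i]] by blast
  obtain \<sigma> where \<sigma>1: "\<And>b. b < m i \<Longrightarrow> bij_betw (\<sigma> b) (E i) (E i)"
    and \<sigma>2: "\<And>e. e \<in> E i \<Longrightarrow> bij_betw (\<lambda>b. \<sigma> b e) {..<m i} (E i)"
    using ex_latin_square[OF finite_edges[of i]] by blast
  have \<sigma>E: "\<sigma> b e \<in> E i" if "b < m i" "e \<in> E i" for b e
    using \<sigma>1 that by (auto simp: bij_betw_def)
  have \<sigma>inj: "\<sigma> b e = \<sigma> b f \<longleftrightarrow> e = f" if "b < m i" "e \<in> E i" "f \<in> E i" for b e f
    using \<sigma>1[OF that(1)] that by (auto simp: bij_betw_def inj_on_eq_iff)
  define V where "V l a b = (\<Sum>e\<in>E i. \<eta> a e *\<^sub>C (s (\<sigma> b e) * U l * star (s e)))" for l a b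
  have sandwich: "V l a b * A * star (V l a b) = (\<Sum>e\<in>E i. \<Sum>f\<in>E i. (\<eta> a e * cnj (\<eta> a f)) *\<^sub>C
      (s (\<sigma> b e) * (U l * (star (s e) * A * s f) * star (U l)) * star (s (\<sigma> b f))))" for l a b A
  proof -
    have "V l a b * A = (\<Sum>e\<in>E i. \<eta> a e *\<^sub>C (s (\<sigma> b e) * U l * star (s e) * A))"
      by (simp add: V_def sum_distrib_right scaleC_mult_left)
    moreover have "star (V l a b) = (\<Sum>f\<in>E i. cnj (\<eta> a f) *\<^sub>C (s f * star (U l) * star (s (\<sigma> b f))))"
      by (simp add: V_def star_sum star_scaleC star_mult star_star mult.assoc)
    ultimately show ?thesis
      by (simp add: sum_product scaleC_mult_left scaleC_mult_right mult.assoc mult.commute[of "cnj z" for z])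
  qed
  have V_unitary: "V l a b \<in> unitaries (X0 d s)" if l: "l \<in> {1..n}" and b: "b < m i" for l a b
  proof -
    have Ul: "U l \<in> X0 d s" "star (U l) * U l = 1" "U l * star (U l) = 1"
      using U[OF l] by (auto simp: unitaries_def)
    have "V l a b \<in> X0 d s"
      unfolding V_def X0_def
      by (intro cstar_vs.span_sum cstar_vs.span_scale)
        (use X0_edge_sandwich[OF Ul(1) \<sigma>E[OF b]] in \<open>simp add: X0_def\<close>)
    moreover have "V l a b * star (V l a b) = 1"
    proof -
      have "V l a b * 1 * star (V l a b) = (\<Sum>e\<in>E i. \<Sum>f\<in>E i. if e = f then
          s (\<sigma> b e) * star (s (\<sigma> b e)) else 0)"
        unfolding sandwich
        by (intro sum.cong refl) (auto simp: star_gen_gen \<eta>1 Ul)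
      also have "\<dots> = (\<Sum>e\<in>E i. s (\<sigma> b e) * star (s (\<sigma> b e)))"
        by (simp add: finite_edges)
      also have "\<dots> = (\<Sum>e\<in>E i. s e * star (s e))"
        by (rule sum.reindex_bij_betw[OF \<sigma>1[OF b]])
      finally show ?thesis by (simp add: sum_gen_star)
    qed
    moreover have "star (V l a b) * V l a b = 1"
    proof -
      have cancel: "star (U l) * (U l * x) = x" for x
        by (simp add: Ul(2) flip: mult.assoc)
      have "star (V l a b) * V l a b = (\<Sum>e\<in>E i. \<Sum>f\<in>E i. (cnj (\<eta> a e) * \<eta> a f) *\<^sub>C
          (s e * (star (U l) * (star (s (\<sigma> b e)) * (s (\<sigma> b f) * (U l * star (s f)))))))"
        by (simp add: V_def star_sum star_scaleC star_mult star_star sum_product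
            scaleC_mult_left scaleC_mult_right scaleC_scaleC mult.assoc mult.commute[of "cnj z" for z])
      also have "\<dots> = (\<Sum>e\<in>E i. \<Sum>f\<in>E i. if e = f then s e * star (s e) else 0)"
      proof (intro sum.cong refl)
        fix e f assume ef: "e \<in> E i" "f \<in> E i"
        show "(cnj (\<eta> a e) * \<eta> a f) *\<^sub>C (s e * (star (U l) * (star (s (\<sigma> b e)) * (s (\<sigma> b f) * (U l * star (s f))))))
            = (if e = f then s e * star (s e) else 0)"
          unfolding star_gen_gen_mult[OF \<sigma>E[OF b ef(1)] \<sigma>E[OF b ef(2)]] \<sigma>inj[OF b ef]
          using \<eta>1[OF ef(1), of a] by (auto simp: cancel mult.commute[of "cnj z" for z])
      qed
      also have "\<dots> = 1" by (simp add: finite_edges sum_gen_star)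
      finally show ?thesis .
    qed
    ultimately show ?thesis by (simp add: unitaries_def)
  qed
  define I where "I = {1..n} \<times> {..<m i} \<times> {..<m i}"
  define \<rho> where "\<rho> x = r (fst x) / (real (m i))\<^sup>2" for x :: "nat \<times> nat \<times> nat"
  define W where "W x = V (fst x) (fst (snd x)) (snd (snd x))" for x
  have sum_I: "(\<Sum>x\<in>I. F (fst x) (fst (snd x)) (snd (snd x))) = (\<Sum>l=1..n. \<Sum>a<m i. \<Sum>b<m i. F l a b)"
    for F :: "nat \<Rightarrow> nat \<Rightarrow> nat \<Rightarrow> 'b::comm_monoid_add"
    by (simp add: I_def sum.cartesian_product case_prod_beta)
  have sum_V: "(\<Sum>a<m i. \<Sum>b<m i. V l a b * A * star (V l a b))
      = (real (m i))\<^sup>2 *\<^sub>R amplify i (U l * compress i A * star (U l))" for l A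
  proof -
    define Y where "Y e = U l * (star (s e) * A * s e) * star (U l)" for e
    have "(\<Sum>a<m i. \<Sum>b<m i. V l a b * A * star (V l a b)) = (\<Sum>b<m i. \<Sum>a<m i. V l a b * A * star (V l a b))"
      by (rule sum.swap)
    also have "\<dots> = (\<Sum>b<m i. \<Sum>e\<in>E i. real (m i) *\<^sub>R (s (\<sigma> b e) * Y e * star (s (\<sigma> b e))))"
    proof (intro sum.cong refl)
      fix b
      have "(\<Sum>a<m i. V l a b * A * star (V l a b)) = (\<Sum>e\<in>E i. \<Sum>f\<in>E i. (\<Sum>a<m i. \<eta> a e * cnj (\<eta> a f)) *\<^sub>C
          (s (\<sigma> b e) * (U l * (star (s e) * A * s f) * star (U l)) * star (s (\<sigma> b f))))"
        unfolding sandwich cstar_vs.scale_sum_left by (subst sum.swap, intro sum.cong refl sum.swap)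
      also have "\<dots> = (\<Sum>e\<in>E i. \<Sum>f\<in>E i. if e = f then real (m i) *\<^sub>R (s (\<sigma> b e) * Y e * star (s (\<sigma> b e))) else 0)"
        by (intro sum.cong refl) (simp add: \<eta> Y_def scaleR_eq_scaleC)
      also have "\<dots> = (\<Sum>e\<in>E i. real (m i) *\<^sub>R (s (\<sigma> b e) * Y e * star (s (\<sigma> b e))))"
        by (simp add: finite_edges)
      finally show "(\<Sum>a<m i. V l a b * A * star (V l a b)) = \<dots>" .
    qed
    also have "\<dots> = (\<Sum>e\<in>E i. \<Sum>b<m i. real (m i) *\<^sub>R (s (\<sigma> b e) * Y e * star (s (\<sigma> b e))))"
      by (rule sum.swap)
    also have "\<dots> = (\<Sum>e\<in>E i. \<Sum>f\<in>E i. real (m i) *\<^sub>R (s f * Y e * star (s f)))"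
      by (intro sum.cong refl) (rule sum.reindex_bij_betw[OF \<sigma>2])
    also have "\<dots> = real (m i) *\<^sub>R amplify i (\<Sum>e\<in>E i. Y e)"
      by (subst sum.swap) (simp add: amplify_def sum_distrib_left sum_distrib_right scaleR_sum_right)
    also have "(\<Sum>e\<in>E i. Y e) = real (m i) *\<^sub>R (U l * compress i A * star (U l))"
      using card_pos[of i] by (simp add: Y_def compress_def sum_distrib_left sum_distrib_right)
    finally show ?thesis
      by (simp add: amplify_scaleR power2_eq_square)
  qed
  have "(\<lambda>A. \<Sum>x\<in>I. \<rho> x *\<^sub>R (W x * A * star (W x))) \<in> Ave (unitaries (X0 d s))"
  proof (rule Ave_finite_index)
    show "finite I" by (simp add: I_def)
    show "W x \<in> unitaries (X0 d s)" if "x \<in> I" for x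
      using that V_unitary by (auto simp: I_def W_def)
    show "\<rho> x > 0" if "x \<in> I" for x
      using that r card_pos[of i] by (auto simp: I_def \<rho>_def)
    show "sum \<rho> I = 1"
      unfolding \<rho>_def[abs_def] sum_I[of "\<lambda>l a b. r l / (real (m i))\<^sup>2"]
      using card_pos[of i] sum_r by (simp add: power2_eq_square)
  qed
  moreover have "(\<Sum>x\<in>I. \<rho> x *\<^sub>R (W x * A * star (W x))) = amplify i (\<alpha> (compress i A))" for A
  proof -
    have "(\<Sum>x\<in>I. \<rho> x *\<^sub>R (W x * A * star (W x)))
        = (\<Sum>l=1..n. (r l / (real (m i))\<^sup>2) *\<^sub>R (\<Sum>a<m i. \<Sum>b<m i. V l a b * A * star (V l a b)))"
      unfolding \<rho>_def W_def sum_I[of "\<lambda>l a b. (r l / (real (m i))\<^sup>2) *\<^sub>R (V l a b * A * star (V l a b))"]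
      by (simp only: scaleR_sum_right)
    also have "\<dots> = (\<Sum>l=1..n. r l *\<^sub>R amplify i (U l * compress i A * star (U l)))"
      unfolding sum_V using card_pos[of i] by simp
    also have "\<dots> = amplify i (\<alpha> (compress i A))"
      by (simp add: \<alpha> amplify_scaleR
          linear_sum[OF linear_amplify])
    finally show ?thesis .
  qed
  ultimately show ?thesis by simp
qed

lemma amplify_compress_word_in_Ave:
  "(\<lambda>A. amplify_word w (compress_word w A)) \<in> Ave (unitaries (X0 d s))"
proof (induction w)
  case Nil
  then show ?case by (simp add: id_in_Ave_X0)
next
  case (Cons i w)
  show ?case using amplify_Ave_compress[OF Cons, of i] by simp
qed

lemma compresses_to_imp_closure_Ave:
  assumes "compresses_to A c"
  shows "c *\<^sub>C 1 \<in> closure {\<alpha> A | \<alpha>. \<alpha> \<in> Ave (unitaries (X0 d s))}"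
  unfolding closure_approachable
proof (intro allI impI)
  fix \<epsilon> :: real assume "\<epsilon> > 0"
  then obtain w where w: "norm (compress_word w A - c *\<^sub>C 1) < \<epsilon>"
    using assms unfolding compresses_to_def by blast
  have "dist (amplify_word w (compress_word w A)) (c *\<^sub>C 1) < \<epsilon>"
    unfolding dist_norm using norm_amplify_word_diff_scalar w by (rule order.strict_trans1)
  then show "\<exists>y\<in>{\<alpha> A | \<alpha>. \<alpha> \<in> Ave (unitaries (X0 d s))}. dist y (c *\<^sub>C 1) < \<epsilon>"
    using amplify_compress_word_in_Ave[of w] by (intro bexI) auto
qed

section \<open>Words of edges\<close>

lemma gen_word_simps [simp]:
  "g [] = 1" "g (e # u) = s e * g u" "g (u @ v) = g u * g v"
  by (simp_all add: gen_word_def)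

lemma norm_gen_word:
  assumes "set u \<subseteq> all_edges d"
  shows "norm (g u) = 1"
proof (rule norm_isometry)
  show "star (g u) * g u = 1" using assms
  proof (induction u)
    case (Cons e u)
    then obtain i where "e \<in> E i" by (auto simp: all_edges_def)
    then show ?case using Cons by (simp add: star_mult mult.assoc star_gen_gen_mult)
  qed simp
qed

text \<open>
  The commutation relations move the first edge of colour \<open>i\<close> past the edges of other colours in
  front of it; these edges may change, but they keep their colours.
\<close>

lemma bring_edge_to_front:
  assumes "set u \<subseteq> all_edges d" "set u \<inter> E i \<noteq> {}"
  shows "\<exists>f\<in>E i. \<exists>u'. set u' \<subseteq> all_edges d \<and> length u = Suc (length u') \<and> g u = s f * g u'"
  using assms
proof (induction u)
  case (Cons e u)
  show ?case
  proof (cases "e \<in> E i")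
    case True
    then show ?thesis using Cons.prems by (intro bexI[of _ e] exI[of _ u]) auto
  next
    case False
    obtain j where j: "e \<in> E j" using Cons.prems by (auto simp: all_edges_def)
    have "j \<noteq> i" using j False by auto
    have "set u \<subseteq> all_edges d" "set u \<inter> E i \<noteq> {}" using Cons.prems False by auto
    from Cons.IH[OF this] obtain f u' where f: "f \<in> E i"
      and u': "set u' \<subseteq> all_edges d" "length u = Suc (length u')" "g u = s f * g u'"
      by blast
    obtain f' e' where f'e': "f' \<in> E i" "e' \<in> E j" "s e * s f = s f' * s e'"
      using swap_edges[OF \<open>j \<noteq> i\<close> j f] by blast
    have "g (e # u) = s e * s f * g u'" by (simp add: u'(3) mult.assoc)
    also have "\<dots> = s f' * g (e' # u')" by (simp add: f'e'(3) mult.assoc)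
    finally have "g (e # u) = s f' * g (e' # u')" .
    moreover have "set (e' # u') \<subseteq> all_edges d" using u'(1) f'e'(2) by (auto simp: all_edges_def)
    moreover have "length (e # u) = Suc (length (e' # u'))" using u'(2) by simp
    ultimately show ?thesis using f'e'(1) by blast
  qed
qed simp

text \<open>
  Insert \<open>1 = \<Sum>\<^sub>x s\<^sub>x s\<^sub>x\<^sup>*\<close> over \<open>x \<in> E i\<close> on the right and rewrite \<open>f x\<close> as \<open>e' f'\<close> with \<open>e' \<in> E i\<close>.  The
  summand of \<open>x\<close> survives only if \<open>e' = e\<close>, that is, if \<open>(f', x)\<close> is a minimal common extension of
  \<open>e\<close> and \<open>f\<close>, and the little pull-back property allows at most one of these.
\<close>

lemma star_gen_gen_pullback:
  assumes lp: "little_pullback d" and ij: "i \<noteq> j" and e: "e \<in> E i" and f: "f \<in> E j"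
  shows "star (s e) * s f = 0 \<or> (\<exists>f'\<in>E j. \<exists>e'\<in>E i. star (s e) * s f = s f' * star (s e'))"
proof -
  define t where "t x = star (s e) * (s f * s x) * star (s x)" for x
  have "star (s e) * s f = star (s e) * s f * (\<Sum>x\<in>E i. s x * star (s x))"
    by (simp add: sum_gen_star)
  then have expand: "star (s e) * s f = (\<Sum>x\<in>E i. t x)"
    by (simp add: t_def sum_distrib_left mult.assoc)
  have t_cases: "t x = 0 \<or> (\<exists>f'\<in>E j. e * f' = f * x \<and> t x = s f' * star (s x))" if x: "x \<in> E i" for x
  proof -
    have "j \<noteq> i" using ij by simp
    from swap_edges[OF this f x] obtain e' f' where ef: "e' \<in> E i" "f' \<in> E j" "f * x = e' * f'"
      "s f * s x = s e' * s f'"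
      by blast
    have "t x = (if e = e' then s f' * star (s x) else 0)"
      unfolding t_def ef(4) by (simp add: star_gen_gen_mult[OF e ef(1)])
    then show ?thesis using ef by auto
  qed
  have in_Lambda_min: "(a, x) \<in> Lambda_min d e f" if "a \<in> E j" "x \<in> E i" "e * a = f * x" for a x
    using that e f ij
    by (auto simp: Lambda_min_def degree_mult edges_def vec_eq_iff axis_def)
  have "finite (Lambda_min d e f)" "card (Lambda_min d e f) \<le> Suc 0"
    using lp e f ij unfolding little_pullback_def by auto
  then have unique: "p = q" if "p \<in> Lambda_min d e f" "q \<in> Lambda_min d e f" for p q
    using that by (simp add: card_le_Suc0_iff_eq)
  show ?thesis
  proof (cases "\<exists>x\<in>E i. t x \<noteq> 0")
    case False
    then show ?thesis by (simp add: expand)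
  next
    case True
    then obtain x where x: "x \<in> E i" "t x \<noteq> 0" by blast
    then obtain a where a: "a \<in> E j" "e * a = f * x" "t x = s a * star (s x)"
      using t_cases[OF x(1)] by blast
    have "t y = 0" if y: "y \<in> E i" "y \<noteq> x" for y
    proof (rule ccontr)
      assume "t y \<noteq> 0"
      then obtain b where b: "b \<in> E j" "e * b = f * y" using t_cases[OF y(1)] by blast
      have "(a, x) = (b, y)"
        using unique in_Lambda_min[OF a(1) x(1) a(2)] in_Lambda_min[OF b(1) y(1) b(2)] by blast
      then show False using y by simp
    qed
    then have "(\<Sum>y\<in>E i - {x}. t y) = 0" by (intro sum.neutral) auto
    then have "star (s e) * s f = s a * star (s x)"
      unfolding expand using sum.remove[OF finite_edges x(1), of t] a(3) by simp
    then show ?thesis using a(1) x(1) by blast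
  qed
qed

lemma star_word_gen_pullback:
  assumes lp: "little_pullback d"
    and "set v \<subseteq> all_edges d" "set v \<inter> E i = {}" "f \<in> E i"
  shows "star (g v) * s f = 0 \<or> (\<exists>f'\<in>E i. \<exists>v'. set v' \<subseteq> all_edges d \<and> set v' \<inter> E i = {} \<and>
           star (g v) * s f = s f' * star (g v'))"
  using assms(2-)
proof (induction v arbitrary: f)
  case Nil
  then show ?case by (intro disjI2 bexI[of _ f] exI[of _ "[]"]) auto
next
  case (Cons e v)
  obtain j where j: "e \<in> E j" using Cons.prems by (auto simp: all_edges_def)
  have ji: "j \<noteq> i" using j Cons.prems by auto
  have split: "star (g (e # v)) * s f = star (g v) * (star (s e) * s f)"
    by (simp add: star_mult mult.assoc)
  from star_gen_gen_pullback[OF lp ji j Cons.prems(3)] show ?case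
  proof
    assume "star (s e) * s f = 0"
    then show ?thesis unfolding split by simp
  next
    assume "\<exists>f'\<in>E i. \<exists>e'\<in>E j. star (s e) * s f = s f' * star (s e')"
    then obtain f1 e1 where 1: "f1 \<in> E i" "e1 \<in> E j" "star (s e) * s f = s f1 * star (s e1)" by blast
    have split1: "star (g (e # v)) * s f = star (g v) * s f1 * star (s e1)"
      unfolding split 1(3) by (simp add: mult.assoc)
    have "set v \<subseteq> all_edges d" "set v \<inter> E i = {}" using Cons.prems by auto
    from Cons.IH[OF this 1(1)] show ?thesis
    proof
      assume "star (g v) * s f1 = 0"
      then show ?thesis unfolding split1 by simp
    next
      assume "\<exists>f'\<in>E i. \<exists>v'. set v' \<subseteq> all_edges d \<and> set v' \<inter> E i = {} \<and> star (g v) * s f1 = s f' * star (g v')"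
      then obtain f2 v' where 2: "f2 \<in> E i" "set v' \<subseteq> all_edges d" "set v' \<inter> E i = {}"
        "star (g v) * s f1 = s f2 * star (g v')" by blast
      have "star (g (e # v)) * s f = s f2 * star (g (e1 # v'))"
        unfolding split1 2(4) by (simp add: star_mult mult.assoc)
      moreover have "set (e1 # v') \<subseteq> all_edges d" using 1 2 by (auto simp: all_edges_def)
      moreover have "set (e1 # v') \<inter> E i = {}" using 1 2 ji edges_disjoint by auto
      ultimately show ?thesis using 2(1) by blast
    qed
  qed
qed

section \<open>Compressing monomials\<close>

lemma compress_gen_mult:
  assumes "f \<in> E i"
  shows "compress i (s f * A) = (1 / real (m i)) *\<^sub>R (A * s f)"
proof -
  have "(\<Sum>e\<in>E i. star (s e) * (s f * A) * s e) = (\<Sum>e\<in>E i. if e = f then A * s f else 0)"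
    by (intro sum.cong refl) (simp add: star_gen_gen_mult[OF _ assms])
  then show ?thesis using assms by (simp add: compress_def finite_edges)
qed

lemma compress_two_sided:
  assumes "set u \<subseteq> all_edges d" "set u \<inter> E i \<noteq> {}" "set v \<subseteq> all_edges d" "set v \<inter> E i \<noteq> {}"
  shows "\<exists>u' v' c. set u' \<subseteq> all_edges d \<and> set v' \<subseteq> all_edges d \<and> length u' < length u \<and> length v' < length v
     \<and> compress i (g u * star (g v)) = c *\<^sub>C (g u' * star (g v'))"
proof -
  obtain f u' where u: "f \<in> E i" "set u' \<subseteq> all_edges d" "length u = Suc (length u')" "g u = s f * g u'"
    using bring_edge_to_front[OF assms(1,2)] by blast
  obtain h v' where v: "h \<in> E i" "set v' \<subseteq> all_edges d" "length v = Suc (length v')" "g v = s h * g v'"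
    using bring_edge_to_front[OF assms(3,4)] by blast
  have "compress i (g u * star (g v)) = (1 / real (m i)) *\<^sub>R (g u' * star (g v') * (star (s h) * s f))"
    using compress_gen_mult[OF u(1), of "g u' * star (g v)"] by (simp add: u(4) v(4) star_mult mult.assoc)
  also have "\<dots> = (if h = f then complex_of_real (1 / real (m i)) else 0) *\<^sub>C (g u' * star (g v'))"
    by (simp add: star_gen_gen[OF v(1) u(1)] scaleR_eq_scaleC)
  finally show ?thesis using u v by (intro exI conjI) auto
qed

text \<open>
  Bringing an edge of colour \<open>i\<close> to the front of \<open>u\<close>, the compression removes it there and
  multiplies by its generator on the right; since \<open>v\<close> has no edge of colour \<open>i\<close>, this generator
  passes back through \<open>star (g v)\<close> as a single generator of colour \<open>i\<close>, or yields zero.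
\<close>

lemma compress_one_sided:
  assumes lp: "little_pullback d"
    and u: "set u \<subseteq> all_edges d" "set u \<inter> E i \<noteq> {}" and v: "set v \<subseteq> all_edges d" "set v \<inter> E i = {}"
  shows "compress i (g u * star (g v)) = 0 \<or>
    (\<exists>u' v'. set u' \<subseteq> all_edges d \<and> set u' \<inter> E i \<noteq> {} \<and> set v' \<subseteq> all_edges d \<and> set v' \<inter> E i = {} \<and>
       compress i (g u * star (g v)) = (1 / real (m i)) *\<^sub>R (g u' * star (g v')))"
proof -
  obtain f w where f: "f \<in> E i" and w: "set w \<subseteq> all_edges d" "g u = s f * g w"
    using bring_edge_to_front[OF u] by blast
  have eq: "compress i (g u * star (g v)) = (1 / real (m i)) *\<^sub>R (g w * (star (g v) * s f))"
    using compress_gen_mult[OF f, of "g w * star (g v)"] by (simp add: w(2) mult.assoc)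
  from star_word_gen_pullback[OF lp v f] show ?thesis
  proof
    assume "star (g v) * s f = 0"
    then show ?thesis unfolding eq by simp
  next
    assume "\<exists>f'\<in>E i. \<exists>v'. set v' \<subseteq> all_edges d \<and> set v' \<inter> E i = {} \<and> star (g v) * s f = s f' * star (g v')"
    then obtain f' v' where v': "f' \<in> E i" "set v' \<subseteq> all_edges d" "set v' \<inter> E i = {}"
      "star (g v) * s f = s f' * star (g v')" by blast
    have "compress i (g u * star (g v)) = (1 / real (m i)) *\<^sub>R (g (w @ [f']) * star (g v'))"
      unfolding eq v'(4) by (simp add: mult.assoc)
    moreover have "set (w @ [f']) \<subseteq> all_edges d" "set (w @ [f']) \<inter> E i \<noteq> {}"
      using w v' by (auto simp: all_edges_def)
    ultimately show ?thesis using v'(2,3) by blast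
  qed
qed

lemma compress_zero: "compress i 0 = 0"
  by (simp add: compress_def)

lemma compress_word_zero: "compress_word w 0 = 0"
  by (induction w) (simp_all add: compress_zero)

lemma norm_compress_replicate_one_sided:
  assumes lp: "little_pullback d"
    and "set u \<subseteq> all_edges d" "set u \<inter> E i \<noteq> {}" and "set v \<subseteq> all_edges d" "set v \<inter> E i = {}"
  shows "norm (compress_word (replicate n i) (g u * star (g v))) \<le> (1 / real (m i)) ^ n"
  using assms(2-)
proof (induction n arbitrary: u v)
  case 0
  then show ?case using norm_mult_ineq[of "g u" "star (g v)"] by (simp add: norm_gen_word)
next
  case (Suc n)
  from compress_one_sided[OF lp Suc.prems] show ?case
  proof
    assume "compress i (g u * star (g v)) = 0"
    then have "compress_word (replicate (Suc n) i) (g u * star (g v)) = 0"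
      by (simp only: replicate_Suc fold_simps compress_word_zero)
    then show ?thesis by simp
  next
    assume "\<exists>u' v'. set u' \<subseteq> all_edges d \<and> set u' \<inter> E i \<noteq> {} \<and> set v' \<subseteq> all_edges d \<and> set v' \<inter> E i = {} \<and>
       compress i (g u * star (g v)) = (1 / real (m i)) *\<^sub>R (g u' * star (g v'))"
    then obtain u' v' where uv: "set u' \<subseteq> all_edges d" "set u' \<inter> E i \<noteq> {}" "set v' \<subseteq> all_edges d" "set v' \<inter> E i = {}"
      and eq: "compress i (g u * star (g v)) = (1 / real (m i)) *\<^sub>R (g u' * star (g v'))" by blast
    have "norm (compress_word (replicate (Suc n) i) (g u * star (g v)))
        = 1 / real (m i) * norm (compress_word (replicate n i) (g u' * star (g v')))"
      by (simp only: replicate_Suc fold_simps eq compress_word_scaleR) simp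
    also have "\<dots> \<le> 1 / real (m i) * (1 / real (m i)) ^ n"
      using Suc.IH[OF uv] by (intro mult_left_mono) auto
    finally show ?thesis by simp
  qed
qed

lemma compresses_to_zero_one_sided:
  assumes lp: "little_pullback d" and m: "m i \<ge> 2"
    and uv: "set u \<subseteq> all_edges d" "set u \<inter> E i \<noteq> {}" "set v \<subseteq> all_edges d" "set v \<inter> E i = {}"
  shows "compresses_to (g u * star (g v)) 0"
  unfolding compresses_to_def
proof (intro allI impI)
  fix \<epsilon> :: real assume "\<epsilon> > 0"
  moreover have "1 / real (m i) < 1" using m by simp
  ultimately obtain n where "(1 / real (m i)) ^ n < \<epsilon>" using real_arch_pow_inv by blast
  then have "norm (compress_word (replicate n i) (g u * star (g v)) - 0 *\<^sub>C 1) < \<epsilon>"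
    using norm_compress_replicate_one_sided[OF lp uv, of n] by simp
  then show "\<exists>w. norm (compress_word w (g u * star (g v)) - 0 *\<^sub>C 1) < \<epsilon>" by blast
qed

text \<open>
  Induction on the length of \<open>u\<close>.  A colour common to both words shortens them; once the words have
  no colour in common, any remaining colour is one-sided and forces the limit \<open>0\<close>, and if none
  remains the monomial is the unit.
\<close>

lemma ex_compresses_to_monomial:
  assumes lp: "little_pullback d" and m: "\<And>i. m i \<ge> 2"
    and "set u \<subseteq> all_edges d" "set v \<subseteq> all_edges d"
  shows "\<exists>c. compresses_to (g u * star (g v)) c"
  using assms(3-)
proof (induction "length u" arbitrary: u v rule: less_induct)
  case less
  consider (two) i where "set u \<inter> E i \<noteq> {}" "set v \<inter> E i \<noteq> {}"
    | (left) i where "set u \<inter> E i \<noteq> {}" "set v \<inter> E i = {}"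
    | (right) i where "set v \<inter> E i \<noteq> {}" "set u \<inter> E i = {}"
    | (none) "\<forall>i. set u \<inter> E i = {} \<and> set v \<inter> E i = {}"
    by blast
  then show ?case
  proof cases
    case two
    from compress_two_sided[OF less.prems(1) two(1) less.prems(2) two(2)]
    obtain u' v' c where uv: "set u' \<subseteq> all_edges d" "set v' \<subseteq> all_edges d" "length u' < length u"
      and eq: "compress i (g u * star (g v)) = c *\<^sub>C (g u' * star (g v'))"
      by blast
    obtain b where "compresses_to (g u' * star (g v')) b"
      using less.hyps[OF uv(3) uv(1,2)] by blast
    then have "compresses_to (compress i (g u * star (g v))) (c * b)"
      unfolding eq by (rule compresses_to_scaleC)
    then show ?thesis using compresses_to_of_compress by blast
  next
    case left
    then show ?thesis
      using compresses_to_zero_one_sided[OF lp m less.prems(1) left(1) less.prems(2) left(2)] by blast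
  next
    case right
    then have "compresses_to (g v * star (g u)) 0"
      using compresses_to_zero_one_sided[OF lp m less.prems(2) right(1) less.prems(1) right(2)] by blast
    from compresses_to_star[OF this] show ?thesis
      by (auto simp: star_mult star_star)
  next
    case none
    have "w = []" if w: "set w \<subseteq> all_edges d" and no: "\<And>i. set w \<inter> E i = {}" for w
    proof (cases w)
      case (Cons e w')
      then have "e \<in> all_edges d" using w by simp
      then obtain i where "e \<in> E i" unfolding all_edges_def by blast
      then show ?thesis using no[of i] Cons by simp
    qed
    then have "u = []" "v = []" using none less.prems by simp_all
    then show ?thesis using compresses_to_one by auto
  qed
qed

section \<open>Monomials span a dense subspace\<close>

definition monomial_span :: "'a set" where
  "monomial_span = cstar_vs.span {g u * star (g v) | u v. set u \<subseteq> all_edges d \<and> set v \<subseteq> all_edges d}"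

lemma monomial_in_span:
  "set u \<subseteq> all_edges d \<Longrightarrow> set v \<subseteq> all_edges d \<Longrightarrow> g u * star (g v) \<in> monomial_span"
  unfolding monomial_span_def by (intro cstar_vs.span_base) blast

lemma monomial_span_linear_image:
  assumes "\<And>u v. set u \<subseteq> all_edges d \<Longrightarrow> set v \<subseteq> all_edges d \<Longrightarrow> h (g u * star (g v)) \<in> monomial_span"
    and add: "\<And>x y. h (x + y) = h x + h y" and scale: "\<And>c x. h (c *\<^sub>C x) = c *\<^sub>C h x"
    and x: "x \<in> monomial_span"
  shows "h x \<in> monomial_span"
proof -
  have "h 0 = 0" using scale[of 0 0] by simp
  then have "cstar_vs.subspace {x. h x \<in> monomial_span}"
    unfolding monomial_span_def
    by (intro cstar_vs.subspaceI)
      (auto simp: add scale cstar_vs.span_zero intro: cstar_vs.span_add cstar_vs.span_scale)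
  then have "monomial_span \<subseteq> {x. h x \<in> monomial_span}"
    unfolding monomial_span_def[of] using assms(1)
    by (intro cstar_vs.span_minimal) (auto simp: monomial_span_def)
  then show ?thesis using x by blast
qed

lemma gen_mult_monomial_span:
  assumes "e \<in> all_edges d" "x \<in> monomial_span"
  shows "s e * x \<in> monomial_span"
proof (rule monomial_span_linear_image[OF _ _ _ assms(2)])
  fix u v assume "set u \<subseteq> all_edges d" "set v \<subseteq> all_edges d"
  then show "s e * (g u * star (g v)) \<in> monomial_span"
    using monomial_in_span[of "e # u" v] assms(1) by (simp add: mult.assoc)
qed (simp_all add: distrib_left scaleC_mult_right)

lemma monomial_span_mult_star_word:
  assumes "set w \<subseteq> all_edges d" "x \<in> monomial_span"
  shows "x * star (g w) \<in> monomial_span"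
proof (rule monomial_span_linear_image[OF _ _ _ assms(2)])
  fix u v assume "set u \<subseteq> all_edges d" "set v \<subseteq> all_edges d"
  then show "g u * star (g v) * star (g w) \<in> monomial_span"
    using monomial_in_span[of u "w @ v"] assms(1) by (simp add: star_mult mult.assoc)
qed (simp_all add: distrib_right scaleC_mult_left)

lemma star_gen_word_in_monomial_span:
  assumes lp: "little_pullback d" and "set u \<subseteq> all_edges d" "e \<in> E i"
  shows "star (s e) * g u \<in> monomial_span"
  using assms(2,3)
proof (induction u arbitrary: e)
  case Nil
  then show ?case using monomial_in_span[of "[]" "[e]"] by (auto simp: all_edges_def)
next
  case (Cons f u)
  obtain j where j: "f \<in> E j" using Cons.prems by (auto simp: all_edges_def)
  have u: "set u \<subseteq> all_edges d" using Cons.prems by auto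
  have zero: "0 \<in> monomial_span" by (simp add: monomial_span_def cstar_vs.span_zero)
  show ?case
  proof (cases "i = j")
    case True
    then show ?thesis
      using zero monomial_in_span[OF u, of "[]"] Cons.prems(2) j
      by (simp add: star_gen_gen_mult)
  next
    case False
    have split: "star (s e) * g (f # u) = star (s e) * s f * g u" by (simp add: mult.assoc)
    from star_gen_gen_pullback[OF lp False Cons.prems(2) j] show ?thesis
    proof
      assume "star (s e) * s f = 0"
      then show ?thesis unfolding split using zero by simp
    next
      assume "\<exists>f'\<in>E j. \<exists>e'\<in>E i. star (s e) * s f = s f' * star (s e')"
      then obtain f' e' where fe: "f' \<in> E j" "e' \<in> E i" "star (s e) * s f = s f' * star (s e')" by blast
      have "s f' * (star (s e') * g u) \<in> monomial_span"
        using fe(1) by (intro gen_mult_monomial_span Cons.IH[OF u fe(2)]) (auto simp: all_edges_def)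
      then show ?thesis unfolding split fe(3) by (simp add: mult.assoc)
    qed
  qed
qed

lemma star_gen_mult_monomial_span:
  assumes lp: "little_pullback d" and "e \<in> all_edges d" "x \<in> monomial_span"
  shows "star (s e) * x \<in> monomial_span"
proof (rule monomial_span_linear_image[OF _ _ _ assms(3)])
  fix u v assume uv: "set u \<subseteq> all_edges d" "set v \<subseteq> all_edges d"
  obtain i where i: "e \<in> E i" using assms(2) by (auto simp: all_edges_def)
  show "star (s e) * (g u * star (g v)) \<in> monomial_span"
    using monomial_span_mult_star_word[OF uv(2) star_gen_word_in_monomial_span[OF lp uv(1) i]]
    by (simp add: mult.assoc)
qed (simp_all add: distrib_left scaleC_mult_right)

lemma closure_monomial_span_mult:
  assumes "\<And>x. x \<in> monomial_span \<Longrightarrow> b * x \<in> closure monomial_span" "x \<in> closure monomial_span"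
  shows "b * x \<in> closure monomial_span"
proof -
  have "(\<lambda>x. b * x) ` closure monomial_span \<subseteq> closure monomial_span"
    by (rule image_closure_subset) (use assms(1) in \<open>auto intro!: continuous_intros\<close>)
  then show ?thesis using assms(2) by blast
qed

lemma closure_monomial_span_scaleC:
  assumes "x \<in> closure monomial_span"
  shows "c *\<^sub>C x \<in> closure monomial_span"
proof -
  have "(c *\<^sub>C 1) * y \<in> closure monomial_span" if "y \<in> monomial_span" for y
  proof -
    have "c *\<^sub>C y \<in> monomial_span"
      using that by (simp add: monomial_span_def cstar_vs.span_scale)
    then show ?thesis using closure_subset by (auto simp: scaleC_mult_left)
  qed
  from closure_monomial_span_mult[OF this assms] show ?thesis by (simp add: scaleC_mult_left)
qed

lemma closure_monomial_span_add:
  assumes "x \<in> closure monomial_span" "y \<in> closure monomial_span"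
  shows "x + y \<in> closure monomial_span"
proof -
  obtain a where a: "\<forall>n. a n \<in> monomial_span" "a \<longlonglongrightarrow> x"
    using closure_sequential[THEN iffD1, OF assms(1)] by blast
  obtain b where b: "\<forall>n. b n \<in> monomial_span" "b \<longlonglongrightarrow> y"
    using closure_sequential[THEN iffD1, OF assms(2)] by blast
  have "a n + b n \<in> monomial_span" for n
    using a(1) b(1) by (simp add: monomial_span_def cstar_vs.span_add)
  then show ?thesis
    by (intro closure_sequential[THEN iffD2] exI[of _ "\<lambda>n. a n + b n"] conjI allI
        tendsto_add a(2) b(2))
qed

text \<open>
  Since left multiplication by the generators and their adjoints preserves the span of the monomials,
  the elements \<open>b\<close> such that \<open>b\<close> and \<open>star b\<close> multiply its closure into itself form a closed
  star-subalgebra containing the generators.  It is therefore the whole algebra, and applying it to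
  the unit, which is a monomial, gives every element.
\<close>

lemma closure_monomial_span_eq_UNIV:
  assumes lp: "little_pullback d"
    and gen: "\<And>S. star_subalgebra S \<Longrightarrow> closed S \<Longrightarrow> s ` all_edges d \<subseteq> S \<Longrightarrow> S = UNIV"
  shows "closure monomial_span = UNIV"
proof -
  define M where "M = closure monomial_span"
  define T where "T = {b. \<forall>x\<in>M. b * x \<in> M \<and> star b * x \<in> M}"
  have add: "x + y \<in> M" if "x \<in> M" "y \<in> M" for x y
    using closure_monomial_span_add that unfolding M_def by blast
  have scale: "c *\<^sub>C x \<in> M" if "x \<in> M" for c x
    using closure_monomial_span_scaleC that unfolding M_def by blast
  have "star_subalgebra T"
    unfolding star_subalgebra_def T_def
    by (auto simp: distrib_right star_add star_mult star_star star_scaleC scaleC_mult_left mult.assoc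
        intro: add scale)
  moreover have "closed T"
  proof -
    have "T = (\<Inter>x\<in>M. (\<lambda>b. b * x) -` M \<inter> (\<lambda>b. star b * x) -` M)"
      unfolding T_def by auto
    also have "closed \<dots>"
      unfolding M_def
      by (intro closed_INT ballI closed_Int closed_vimage closed_closure continuous_intros continuous_on_star)
    finally show ?thesis .
  qed
  moreover have "s ` all_edges d \<subseteq> T"
  proof
    fix b assume "b \<in> s ` all_edges d"
    then obtain e where e: "e \<in> all_edges d" "b = s e" by blast
    have "s e * x \<in> M" "star (s e) * x \<in> M" if "x \<in> M" for x
      using closure_monomial_span_mult[of "s e" x] closure_monomial_span_mult[of "star (s e)" x]
        gen_mult_monomial_span[OF e(1)] star_gen_mult_monomial_span[OF lp e(1)] that closure_subset
      unfolding M_def by blast+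
    then show "b \<in> T" by (simp add: T_def e(2))
  qed
  ultimately have T: "T = UNIV" by (rule gen)
  have "1 \<in> M"
    using monomial_in_span[of "[]" "[]"] closure_subset unfolding M_def by auto
  then have "b \<in> M" for b
    using T unfolding T_def by (metis (mono_tags, lifting) UNIV_I mem_Collect_eq mult_1_right)
  then show ?thesis unfolding M_def by blast
qed

lemma ex_compresses_to:
  assumes lp: "little_pullback d" and m: "\<And>i. m i \<ge> 2"
    and gen: "\<And>S. star_subalgebra S \<Longrightarrow> closed S \<Longrightarrow> s ` all_edges d \<subseteq> S \<Longrightarrow> S = UNIV"
  shows "\<exists>c. compresses_to A c"
proof (rule ex_compresses_to_closure)
  have "cstar_vs.subspace {B. \<exists>c. compresses_to B c}"
    by (intro cstar_vs.subspaceI) (use compresses_to_zero compresses_to_add compresses_to_scaleC in blast)+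
  then have "monomial_span \<subseteq> {B. \<exists>c. compresses_to B c}"
    unfolding monomial_span_def
    by (intro cstar_vs.span_minimal) (use ex_compresses_to_monomial[OF lp m] in auto)
  then show "A \<in> closure {B. \<exists>c. compresses_to B c}"
    using closure_monomial_span_eq_UNIV[OF lp gen] closure_mono by blast
qed

section \<open>Simplicity excludes colours with a single edge\<close>

lemma central_of_commutes_generators:
  assumes gen: "\<And>S. star_subalgebra S \<Longrightarrow> closed S \<Longrightarrow> s ` all_edges d \<subseteq> S \<Longrightarrow> S = UNIV"
    and Z: "star Z * Z = 1" "Z * star Z = 1"
    and comm: "\<And>f. f \<in> all_edges d \<Longrightarrow> Z * s f = s f * Z"
  shows "Z * y = y * Z"
proof -
  define T where "T = {x. Z * x = x * Z \<and> Z * star x = star x * Z}"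
  have "star_subalgebra T"
    unfolding star_subalgebra_def
  proof (intro conjI ballI allI)
    show "1 \<in> T" by (simp add: T_def)
  next
    fix x y assume xy: "x \<in> T" "y \<in> T"
    have "Z * (x * y) = x * y * Z" "Z * (star y * star x) = star y * star x * Z"
      using xy unfolding T_def by (metis (mono_tags, lifting) mem_Collect_eq mult.assoc)+
    then show "x + y \<in> T" "x * y \<in> T"
      using xy by (simp_all add: T_def distrib_left distrib_right star_add star_mult)
  next
    fix c x assume "x \<in> T"
    then show "c *\<^sub>C x \<in> T" "star x \<in> T"
      by (simp_all add: T_def star_scaleC star_star scaleC_mult_left scaleC_mult_right)
  qed
  moreover have "closed T"
    unfolding T_def
    by (intro closed_Collect_conj closed_Collect_eq continuous_intros continuous_on_star)
  moreover have "s ` all_edges d \<subseteq> T"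
  proof
    fix b assume "b \<in> s ` all_edges d"
    then obtain f where f: "f \<in> all_edges d" "b = s f" by blast
    \<comment> \<open>For the unitary \<open>Z\<close>, commuting with \<open>s f\<close> implies commuting with its adjoint.\<close>
    have "Z * star (s f) = Z * star (Z * s f * star Z)"
      unfolding comm[OF f(1)] by (simp add: mult.assoc Z)
    also have "\<dots> = (Z * Z) * star (s f) * star Z"
      by (simp add: star_mult star_star mult.assoc)
    finally have 1: "Z * star (s f) = (Z * Z) * star (s f) * star Z" .
    have "star Z * (Z * star (s f)) * Z = star Z * ((Z * Z) * star (s f) * star Z) * Z"
      by (simp only: 1)
    then have "(star Z * Z) * star (s f) * Z = (star Z * Z) * Z * star (s f) * (star Z * Z)"
      by (simp only: mult.assoc)
    then have "star (s f) * Z = Z * star (s f)" by (simp add: Z)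
    then show "b \<in> T" using comm[OF f(1)] by (simp add: T_def f(2))
  qed
  ultimately have "T = UNIV" by (rule gen)
  then have "y \<in> T" by simp
  then show ?thesis by (simp add: T_def)
qed

text \<open>
  The relations between generators are homogeneous in each colour, so the generators of one
  colour may be multiplied by a common phase.
\<close>

lemma gauge_rep:
  assumes t: "cmod t = 1"
  shows "cuntz_rep d cstar_univ (\<lambda>f. if f \<in> E i then t *\<^sub>C s f else s f)"
proof -
  define \<tau> where "\<tau> p = (if p = i then t else 1)" for p
  have "cnj t * t = 1" using t by (simp add: complex_norm_square[symmetric] mult.commute)
  then have \<tau>: "cnj (\<tau> p) * \<tau> p = 1" for p by (simp add: \<tau>_def)
  then have \<tau>': "\<tau> p * cnj (\<tau> p) = 1" for p by (simp add: mult.commute)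
  have val: "(if f \<in> E i then t *\<^sub>C s f else s f) = \<tau> p *\<^sub>C s f" if "f \<in> E p" for f p
    using that edges_disjoint[of f p i] by (auto simp: \<tau>_def)
  have tuple: "cuntz_tuple cstar_univ (E p) (\<lambda>f. if f \<in> E i then t *\<^sub>C s f else s f)" for p
  proof -
    have "star (\<tau> p *\<^sub>C s e) * (\<tau> p *\<^sub>C s f) = (if e = f then 1 else 0)" if "e \<in> E p" "f \<in> E p" for e f
      using that by (simp add: star_scaleC scaleC_mult_left scaleC_mult_right scaleC_scaleC \<tau> \<tau>' star_gen_gen)
    moreover have "(\<Sum>e\<in>E p. (\<tau> p *\<^sub>C s e) * star (\<tau> p *\<^sub>C s e)) = 1"
      by (simp add: star_scaleC scaleC_mult_left scaleC_mult_right scaleC_scaleC \<tau> \<tau>' sum_gen_star)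
    ultimately show ?thesis
      unfolding cuntz_tuple_def by (simp add: val finite_edges cong: sum.cong)
  qed
  show ?thesis
    unfolding cuntz_rep_def
  proof (intro conjI allI ballI impI tuple)
    fix p q e e' f f'
    assume h: "e \<in> E p" "e' \<in> E p" "f \<in> E q" "f' \<in> E q" "p \<noteq> q \<and> e * f = f' * e'"
    show "(if e \<in> E i then t *\<^sub>C s e else s e) \<otimes>\<^bsub>cstar_univ\<^esub> (if f \<in> E i then t *\<^sub>C s f else s f)
        = (if f' \<in> E i then t *\<^sub>C s f' else s f') \<otimes>\<^bsub>cstar_univ\<^esub> (if e' \<in> E i then t *\<^sub>C s e' else s e')"
      unfolding val[OF h(1)] val[OF h(2)] val[OF h(3)] val[OF h(4)]
      using gen_relation[OF _ h(1-4)] h(5)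
      by (simp add: scaleC_mult_left scaleC_mult_right scaleC_scaleC mult.commute)
  qed
qed

lemma finite_all_edges: "finite (all_edges d)"
  unfolding all_edges_def by (simp add: finite_edges)

text \<open>
  Conjugation by the powers of \<open>s e\<close> maps the finite set of generators into itself.  By the
  pigeonhole principle two different powers act on it in the same way, and their quotient
  commutes with every generator.
\<close>

lemma ex_power_commutes_generators:
  assumes e: "E i = {e}"
  shows "\<exists>N>0. \<forall>f\<in>all_edges d. s e ^ N * s f = s f * s e ^ N"
proof -
  let ?u = "s e"
  have eE: "e \<in> E i" using e by simp
  have uu: "star ?u * ?u = 1" using star_gen_gen[OF eE eE] by simp
  have uu': "?u * star ?u = 1" using sum_gen_star[of i] e by simp
  have conj: "\<exists>f'\<in>all_edges d. ?u * s f * star ?u = s f'" if f: "f \<in> all_edges d" for f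
  proof -
    obtain j where j: "f \<in> E j" using f by (auto simp: all_edges_def)
    show ?thesis
    proof (cases "i = j")
      case True
      then have "f = e" using j e by simp
      then show ?thesis using f by (intro bexI[of _ e]) (simp_all add: mult.assoc uu')
    next
      case False
      obtain f' where f': "f' \<in> E j" "?u * s f = s f' * ?u"
        using swap_edges[OF False eE j] e by auto
      then have "?u * s f * star ?u = s f'" by (simp add: mult.assoc uu')
      then show ?thesis using f'(1) by (auto simp: all_edges_def)
    qed
  qed
  have orbit: "\<exists>f'\<in>all_edges d. ?u ^ n * s f * star (?u ^ n) = s f'" if "f \<in> all_edges d" for f n
  proof (induction n)
    case 0
    then show ?case using that by auto
  next
    case (Suc n)
    then obtain f' where "f' \<in> all_edges d" "?u ^ n * s f * star (?u ^ n) = s f'" by blast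
    moreover have "?u ^ Suc n * s f * star (?u ^ Suc n) = ?u * (?u ^ n * s f * star (?u ^ n)) * star ?u"
      by (simp add: star_mult mult.assoc)
    ultimately show ?case using conj by metis
  qed
  define \<Phi> where "\<Phi> n = restrict (\<lambda>f. ?u ^ n * s f * star (?u ^ n)) (all_edges d)" for n
  have "range \<Phi> \<subseteq> (all_edges d) \<rightarrow>\<^sub>E (s ` all_edges d)"
    using orbit by (fastforce simp: \<Phi>_def)
  then have "finite (range \<Phi>)"
    by (rule finite_subset) (simp add: finite_PiE finite_all_edges)
  then have "\<not> inj \<Phi>" using finite_imageD infinite_UNIV_nat by blast
  then obtain a b where ab: "a < b" "\<Phi> a = \<Phi> b"
    unfolding inj_def by (metis linorder_neqE_nat)
  have iso: "star (?u ^ n) * ?u ^ n = 1" for n by (rule isometry_power[OF uu])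
  have "?u ^ (b - a) * s f = s f * ?u ^ (b - a)" if f: "f \<in> all_edges d" for f
  proof -
    let ?Z = "?u ^ (b - a)"
    have "?u ^ a * s f * star (?u ^ a) = ?u ^ b * s f * star (?u ^ b)"
      using fun_cong[OF ab(2), of f] f by (simp add: \<Phi>_def)
    also have "?u ^ b = ?u ^ a * ?Z" using ab(1) by (simp flip: power_add)
    finally have "?u ^ a * s f * star (?u ^ a) = ?u ^ a * ?Z * s f * star (?u ^ a * ?Z)" .
    then have "star (?u ^ a) * (?u ^ a * s f * star (?u ^ a)) * (?u ^ a * ?Z)
        = star (?u ^ a) * (?u ^ a * ?Z * s f * star (?u ^ a * ?Z)) * (?u ^ a * ?Z)"
      by (simp only:)
    then have "(star (?u ^ a) * ?u ^ a) * s f * ((star (?u ^ a) * ?u ^ a) * ?Z)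
        = (star (?u ^ a) * ?u ^ a) * ?Z * s f * (star ?Z * ((star (?u ^ a) * ?u ^ a) * ?Z))"
      by (simp only: star_mult mult.assoc)
    then show ?thesis by (simp add: iso)
  qed
  then show ?thesis using ab(1) by (intro exI[of _ "b - a"]) simp
qed

text \<open>
  A single edge \<open>e\<close> of colour \<open>i\<close> would give a central unitary \<open>Z\<close>, a power of \<open>s e\<close>, which is a
  scalar by simplicity and hence fixed by every unital endomorphism.  The gauge endomorphism for a
  phase \<open>t\<close> with \<open>t\<^sup>N = - 1\<close> maps it to \<open>- Z\<close>.
\<close>

lemma card_edges_ge_2:
  assumes univ: "universal_cuntz_rep d s" and simple: "cstar_simple TYPE('a)"
  shows "m i \<ge> 2"
proof (rule ccontr)
  assume "\<not> m i \<ge> 2"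
  then have "m i = 1" using card_pos[of i] by linarith
  then obtain e where e: "E i = {e}" by (auto simp: card_1_singleton_iff)
  then have eE: "e \<in> E i" by simp
  obtain N where N: "N > 0" "\<And>f. f \<in> all_edges d \<Longrightarrow> s e ^ N * s f = s f * s e ^ N"
    using ex_power_commutes_generators[OF e] by blast
  let ?Z = "s e ^ N"
  have Z: "star ?Z * ?Z = 1"
    by (rule isometry_power) (simp add: star_gen_gen[OF eE eE])
  have "star (star (s e) ^ N) * star (s e) ^ N = 1"
    by (rule isometry_power) (use sum_gen_star[of i] e in \<open>simp add: star_star\<close>)
  then have Z': "?Z * star ?Z = 1" by (simp add: star_power star_star)
  have gen: "S = UNIV" if "star_subalgebra S" "closed S" "s ` all_edges d \<subseteq> S" for S
    using univ that unfolding universal_cuntz_rep_def by blast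
  have central: "?Z * y = y * ?Z" for y
    by (rule central_of_commutes_generators[OF gen Z Z' N(2)])
  obtain c where c: "?Z = c *\<^sub>C 1"
    using central_unitary_scalar[OF simple central Z] by (auto simp: scalars_def)
  define t where "t = cis (pi / N)"
  have t: "cmod t = 1" "t ^ N = -1"
    using N(1) by (simp_all add: t_def Complex.DeMoivre)
  have "\<exists>h. star_hom cstar_univ cstar_univ h \<and> (\<forall>f\<in>all_edges d. h (s f) = (if f \<in> E i then t *\<^sub>C s f else s f))"
    using univ unital_cstar_cstar_univ gauge_rep[OF t(1), of i] unfolding universal_cuntz_rep_def by blast
  then obtain h where h: "star_hom cstar_univ cstar_univ h"
    and hs: "\<forall>f\<in>all_edges d. h (s f) = (if f \<in> E i then t *\<^sub>C s f else s f)" by blast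
  have h_mult: "h (x * y) = h x * h y" and h_one: "h 1 = 1" and h_scale: "h (c *\<^sub>C x) = c *\<^sub>C h x" for x y c
    using h unfolding star_hom_def ring_hom_def by auto
  have "e \<in> all_edges d" using eE by (auto simp: all_edges_def)
  then have "h (s e) = t *\<^sub>C s e" using hs eE by simp
  moreover have "h (s e ^ n) = h (s e) ^ n" for n
    by (induction n) (simp_all add: h_one h_mult)
  ultimately have "h ?Z = t ^ N *\<^sub>C ?Z" by (simp add: scaleC_power)
  then have "h ?Z = - ?Z" by (simp add: t(2))
  moreover have "h ?Z = ?Z" unfolding c by (simp add: h_scale h_one)
  ultimately have "2 *\<^sub>R ?Z = 0" by (simp add: scaleR_2 eq_neg_iff_add_eq_0)
  then have "?Z = 0" by simp
  then show False using Z by simp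
qed

end

section \<open>Averages meeting the scalars\<close>

theorem proposition4p6:
  fixes d :: "'l::monoid_mult \<Rightarrow> nat ^ 'k"
    and s :: "'l \<Rightarrow> 'a::cstar_algebra"
    and A :: 'a
  assumes "single_vertex_kgraph d"
    and "universal_cuntz_rep d s"
    and "aperiodic d s"
    and "little_pullback d"
  shows "closure {\<alpha> A | \<alpha>. \<alpha> \<in> Ave (unitaries (X0 d s))} \<inter> scalars \<noteq> {}"
proof -
  interpret cuntz_family d s
    using assms(1,2) unfolding cuntz_family_def cuntz_family_axioms_def universal_cuntz_rep_def
    by blast
  have simple: "cstar_simple TYPE('a)"
    using assms(3) unfolding aperiodic_def by blast
  have gen: "S = UNIV" if "star_subalgebra S" "closed S" "s ` all_edges d \<subseteq> S" for S
    using assms(2) that unfolding universal_cuntz_rep_def by blast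
  obtain c where "compresses_to A c"
    using ex_compresses_to[OF assms(4) card_edges_ge_2[OF assms(2) simple] gen] by blast
  from compresses_to_imp_closure_Ave[OF this] show ?thesis
    unfolding scalars_def by blast
qed

end
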